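(* If $\Gamma\vdash t:T$ and $t\to_\beta t'$ (one step of $\beta$-reduction, $([x:U]v)u\to_\beta v\{x\mapsto u\}$ in any context), then $\Gamma\vdash t':T$.
   Context: Sorts $\mathcal S=\{\star,\Box\}$; variables $\mathcal X$, each $x$ with a sort $s_x$; symbols $\mathcal F$, each $f$ with a sort $s_f$ and a closed type $\tau_f$, where $\tau_f$ contains no size variables if $s_f=\Box$. A set $\mathcal R$ of rewrite rules, containing no size variables, is given; $\mathcal{CF}^\Box$ denotes the symbols of sort $\Box$ heading no rule left-hand side. Size expressions form a first-order term algebra $\mathcal A$ over size symbols and size variables with a quasi-ordering $\le_{\mathcal A}$ stable under size substitution. Terms: $t::= s\mid x\mid C^a\mid f\mid [x:t]t\mid (x:t)t\mid tt$ ($C\in\mathcal{CF}^\Box$, $a\in\mathcal A$, $f\notin\mathcal{CF}^\Box$). Reduction $\to=\beta\cup\mathcal R$; $T\downarrow U$ means common reduct. Subtyping $\le$: smallest relation closed under $T\le T$; $C^a\vec t\le C^b\vec t$ if $a\le_{\mathcal A}b$; $(x:U)V\le(x:U')V'$ if $U'\le U$, $V\le V'$; $T\le U$ if $T\downarrow T'$, $T'\le U'$, $U'\downarrow U$; transitivity. Typing rules: $\vdash\star:\Box$; if $\vdash\tau_C:\Box$ then $\vdash C^a:\tau_C$ ($C\in\mathcal{CF}^\Box$); if $\vdash\tau_f:s_f$ then $\vdash f:\tau_f\varphi$ for any size substitution $\varphi$ ($f\notin\mathcal{CF}^\Box$); if $\Gamma\vdash T:s_x$ then $\Gamma,x:T\vdash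 x:T$ ($x\notin\mathrm{dom}\Gamma$); if $\Gamma\vdash t:T$ and $\Gamma\vdash U:s_x$ then $\Gamma,x:U\vdash t:T$ ($x\notin\mathrm{dom}\Gamma$); if $\Gamma\vdash U:s$ and $\Gamma,x:U\vdash V:s'$ then $\Gamma\vdash(x:U)V:s'$; if $\Gamma,x:U\vdash v:V$ and $\Gamma\vdash(x:U)V:s$ then $\Gamma\vdash[x:U]v:(x:U)V$; if $\Gamma\vdash t:(x:U)V$ and $\Gamma\vdash u:U$ then $\Gamma\vdash tu:V\{x\mapsto u\}$; if $\Gamma\vdash t:T$, $\Gamma\vdash T':s$ and $T\le T'$ then $\Gamma\vdash t:T'$. Standing assumptions: $\vdash\tau_f:s_f$ for all $f$, $\beta\cup\mathcal R$ is confluent, and rules preserve typing (if $l\to r\in\mathcal R$ and $\Gamma\vdash l\sigma:T$ then $\Gamma\vdash r\sigma:T$).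
   Formalization: The left-hand side of every rewrite rule is assumed to be headed by a symbol (as the phrase "heading no rule left-hand side" suggests); with rules on products, such as (x:A)A → (x:B)B, the claim fails. Infinitely many variables of each sort are assumed. *)

theory Defs
  imports Main "HOL-Library.Confluence"
begin

section \<open>Syntax\<close>

datatype srt = Star | Box

datatype ('h, size_vars: 'z) sexp = SVar 'z | SApp 'h "('h, 'z) sexp list"

primrec sexp_subst :: "('z \<Rightarrow> ('h, 'z) sexp) \<Rightarrow> ('h, 'z) sexp \<Rightarrow> ('h, 'z) sexp" where
  "sexp_subst \<phi> (SVar z) = \<phi> z"
| "sexp_subst \<phi> (SApp h as) = SApp h (map (sexp_subst \<phi>) as)"

text \<open>
  Terms are taken up to renaming of bound variables, which is realised by the locally nameless
  representation: free variables are names, bound variables are indices. Since every variable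
  carries a sort and a bound variable may only be renamed into a variable of the same sort, a
  binder records the sort of the variable it binds. Indices never appear below: binders are only
  built by the functions \<open>lam\<close> and \<open>prd\<close>, which take a variable name.
  The constructor \<open>SSym C a\<close> is the symbol $C$ annotated with the size $a$.
\<close>

datatype ('x, 'f, 'h, 'z) trm =
    Sort srt
  | FVar 'x
  | BVar nat
  | SSym 'f "('h, 'z) sexp"
  | Sym 'f
  | Lam srt "('x, 'f, 'h, 'z) trm" "('x, 'f, 'h, 'z) trm"
  | Prd srt "('x, 'f, 'h, 'z) trm" "('x, 'f, 'h, 'z) trm"
  | App "('x, 'f, 'h, 'z) trm" "('x, 'f, 'h, 'z) trm"

primrec fv :: "('x, 'f, 'h, 'z) trm \<Rightarrow> 'x set" where
  "fv (Sort s) = {}"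
| "fv (FVar x) = {x}"
| "fv (BVar i) = {}"
| "fv (SSym C a) = {}"
| "fv (Sym f) = {}"
| "fv (Lam s U v) = fv U \<union> fv v"
| "fv (Prd s U V) = fv U \<union> fv V"
| "fv (App t u) = fv t \<union> fv u"

primrec term_size_vars :: "('x, 'f, 'h, 'z) trm \<Rightarrow> 'z set" where
  "term_size_vars (Sort s) = {}"
| "term_size_vars (FVar x) = {}"
| "term_size_vars (BVar i) = {}"
| "term_size_vars (SSym C a) = size_vars a"
| "term_size_vars (Sym f) = {}"
| "term_size_vars (Lam s U v) = term_size_vars U \<union> term_size_vars v"
| "term_size_vars (Prd s U V) = term_size_vars U \<union> term_size_vars V"
| "term_size_vars (App t u) = term_size_vars t \<union> term_size_vars u"

primrec close :: "nat \<Rightarrow> 'x \<Rightarrow> ('x, 'f, 'h, 'z) trm \<Rightarrow> ('x, 'f, 'h, 'z) trm" where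
  "close k x (Sort s) = Sort s"
| "close k x (FVar y) = (if y = x then BVar k else FVar y)"
| "close k x (BVar i) = BVar i"
| "close k x (SSym C a) = SSym C a"
| "close k x (Sym f) = Sym f"
| "close k x (Lam s U v) = Lam s (close k x U) (close (Suc k) x v)"
| "close k x (Prd s U V) = Prd s (close k x U) (close (Suc k) x V)"
| "close k x (App t u) = App (close k x t) (close k x u)"

text \<open>
  Simultaneous substitution for free variables. It is capture-avoiding because the terms
  substituted have no dangling index.
\<close>

primrec subst :: "('x \<Rightarrow> ('x, 'f, 'h, 'z) trm) \<Rightarrow> ('x, 'f, 'h, 'z) trm \<Rightarrow> ('x, 'f, 'h, 'z) trm" where
  "subst \<sigma> (Sort s) = Sort s"
| "subst \<sigma> (FVar x) = \<sigma> x"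
| "subst \<sigma> (BVar i) = BVar i"
| "subst \<sigma> (SSym C a) = SSym C a"
| "subst \<sigma> (Sym f) = Sym f"
| "subst \<sigma> (Lam s U v) = Lam s (subst \<sigma> U) (subst \<sigma> v)"
| "subst \<sigma> (Prd s U V) = Prd s (subst \<sigma> U) (subst \<sigma> V)"
| "subst \<sigma> (App t u) = App (subst \<sigma> t) (subst \<sigma> u)"

abbreviation subst1 :: "'x \<Rightarrow> ('x, 'f, 'h, 'z) trm \<Rightarrow> ('x, 'f, 'h, 'z) trm \<Rightarrow> ('x, 'f, 'h, 'z) trm" where
  "subst1 x u \<equiv> subst (FVar(x := u))"

primrec size_subst :: "('z \<Rightarrow> ('h, 'z) sexp) \<Rightarrow> ('x, 'f, 'h, 'z) trm \<Rightarrow> ('x, 'f, 'h, 'z) trm" where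
  "size_subst \<phi> (Sort s) = Sort s"
| "size_subst \<phi> (FVar x) = FVar x"
| "size_subst \<phi> (BVar i) = BVar i"
| "size_subst \<phi> (SSym C a) = SSym C (sexp_subst \<phi> a)"
| "size_subst \<phi> (Sym f) = Sym f"
| "size_subst \<phi> (Lam s U v) = Lam s (size_subst \<phi> U) (size_subst \<phi> v)"
| "size_subst \<phi> (Prd s U V) = Prd s (size_subst \<phi> U) (size_subst \<phi> V)"
| "size_subst \<phi> (App t u) = App (size_subst \<phi> t) (size_subst \<phi> u)"

fun head_symbol :: "('x, 'f, 'h, 'z) trm \<Rightarrow> 'f option" where
  "head_symbol (App t u) = head_symbol t"
| "head_symbol (SSym C a) = Some C"
| "head_symbol (Sym f) = Some f"
| "head_symbol _ = None"


section \<open>The data of the system\<close>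

record ('x, 'f, 'h, 'z) sys =
  var_sort :: "'x \<Rightarrow> srt"
  sym_sort :: "'f \<Rightarrow> srt"
  sym_type :: "'f \<Rightarrow> ('x, 'f, 'h, 'z) trm"
  rules :: "(('x, 'f, 'h, 'z) trm \<times> ('x, 'f, 'h, 'z) trm) set"
  arity :: "'h \<Rightarrow> nat"
  size_le :: "(('h, 'z) sexp \<times> ('h, 'z) sexp) set"

definition CFBox :: "('x, 'f, 'h, 'z) sys \<Rightarrow> 'f set" where
  "CFBox S = {C. sym_sort S C = Box \<and> (\<forall>(l, r) \<in> rules S. head_symbol l \<noteq> Some C)}"

inductive_set sizes :: "('x, 'f, 'h, 'z) sys \<Rightarrow> ('h, 'z) sexp set" for S where
  "SVar z \<in> sizes S"
| "length as = arity S h \<Longrightarrow> \<forall>a \<in> set as. a \<in> sizes S \<Longrightarrow> SApp h as \<in> sizes S"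

definition is_size_subst :: "('x, 'f, 'h, 'z) sys \<Rightarrow> ('z \<Rightarrow> ('h, 'z) sexp) \<Rightarrow> bool" where
  "is_size_subst S \<phi> \<longleftrightarrow> (\<forall>z. \<phi> z \<in> sizes S)"

text \<open>The abstraction $[x:U]v$ and the product $(x:U)V$.\<close>

definition lam :: "('x, 'f, 'h, 'z) sys \<Rightarrow> 'x \<Rightarrow> ('x, 'f, 'h, 'z) trm \<Rightarrow> ('x, 'f, 'h, 'z) trm
    \<Rightarrow> ('x, 'f, 'h, 'z) trm" where
  "lam S x U v = Lam (var_sort S x) U (close 0 x v)"

definition prd :: "('x, 'f, 'h, 'z) sys \<Rightarrow> 'x \<Rightarrow> ('x, 'f, 'h, 'z) trm \<Rightarrow> ('x, 'f, 'h, 'z) trm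
    \<Rightarrow> ('x, 'f, 'h, 'z) trm" where
  "prd S x U V = Prd (var_sort S x) U (close 0 x V)"

lemma close_rename: "y \<notin> fv v \<Longrightarrow> close k y (subst1 x (FVar y) v) = close k x v"
  by (induction v arbitrary: k) auto

lemma alpha:
  assumes "y \<notin> fv v" "var_sort S y = var_sort S x"
  shows "lam S y U (subst1 x (FVar y) v) = lam S x U v"
    and "prd S y U (subst1 x (FVar y) v) = prd S x U v"
  using assms by (simp_all add: lam_def prd_def close_rename)

text \<open>
  The terms of the calculus: no dangling index, and a symbol carries a size annotation
  exactly when it belongs to \<open>CFBox\<close>. All relations below are relations on these terms.
\<close>

inductive is_term :: "('x, 'f, 'h, 'z) sys \<Rightarrow> ('x, 'f, 'h, 'z) trm \<Rightarrow> bool" for S where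
  "is_term S (Sort s)"
| "is_term S (FVar x)"
| "C \<in> CFBox S \<Longrightarrow> a \<in> sizes S \<Longrightarrow> is_term S (SSym C a)"
| "f \<notin> CFBox S \<Longrightarrow> is_term S (Sym f)"
| "is_term S U \<Longrightarrow> is_term S v \<Longrightarrow> is_term S (lam S x U v)"
| "is_term S U \<Longrightarrow> is_term S V \<Longrightarrow> is_term S (prd S x U V)"
| "is_term S t \<Longrightarrow> is_term S u \<Longrightarrow> is_term S (App t u)"


section \<open>Reduction\<close>

inductive context_closure :: "('x, 'f, 'h, 'z) sys
    \<Rightarrow> (('x, 'f, 'h, 'z) trm \<Rightarrow> ('x, 'f, 'h, 'z) trm \<Rightarrow> bool)
    \<Rightarrow> ('x, 'f, 'h, 'z) trm \<Rightarrow> ('x, 'f, 'h, 'z) trm \<Rightarrow> bool" for S P where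
  root: "P t t' \<Longrightarrow> context_closure S P t t'"
| appL: "context_closure S P t t' \<Longrightarrow> is_term S u \<Longrightarrow> context_closure S P (App t u) (App t' u)"
| appR: "is_term S t \<Longrightarrow> context_closure S P u u' \<Longrightarrow> context_closure S P (App t u) (App t u')"
| lamL: "context_closure S P U U' \<Longrightarrow> is_term S v \<Longrightarrow> context_closure S P (lam S x U v) (lam S x U' v)"
| lamR: "is_term S U \<Longrightarrow> context_closure S P v v' \<Longrightarrow> context_closure S P (lam S x U v) (lam S x U v')"
| prdL: "context_closure S P U U' \<Longrightarrow> is_term S V \<Longrightarrow> context_closure S P (prd S x U V) (prd S x U' V)"
| prdR: "is_term S U \<Longrightarrow> context_closure S P V V' \<Longrightarrow> context_closure S P (prd S x U V) (prd S x U V')"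

inductive beta_root :: "('x, 'f, 'h, 'z) sys \<Rightarrow> ('x, 'f, 'h, 'z) trm \<Rightarrow> ('x, 'f, 'h, 'z) trm \<Rightarrow> bool"
  for S where
  "is_term S U \<Longrightarrow> is_term S v \<Longrightarrow> is_term S u \<Longrightarrow> beta_root S (App (lam S x U v) u) (subst1 x u v)"

inductive rule_root :: "('x, 'f, 'h, 'z) sys \<Rightarrow> ('x, 'f, 'h, 'z) trm \<Rightarrow> ('x, 'f, 'h, 'z) trm \<Rightarrow> bool"
  for S where
  "(l, r) \<in> rules S \<Longrightarrow> \<forall>x. is_term S (\<sigma> x) \<Longrightarrow> rule_root S (subst \<sigma> l) (subst \<sigma> r)"

definition beta :: "('x, 'f, 'h, 'z) sys \<Rightarrow> ('x, 'f, 'h, 'z) trm \<Rightarrow> ('x, 'f, 'h, 'z) trm \<Rightarrow> bool" where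
  "beta S = context_closure S (beta_root S)"

definition rewrite :: "('x, 'f, 'h, 'z) sys \<Rightarrow> ('x, 'f, 'h, 'z) trm \<Rightarrow> ('x, 'f, 'h, 'z) trm \<Rightarrow> bool" where
  "rewrite S = context_closure S (rule_root S)"

definition red :: "('x, 'f, 'h, 'z) sys \<Rightarrow> ('x, 'f, 'h, 'z) trm \<Rightarrow> ('x, 'f, 'h, 'z) trm \<Rightarrow> bool" where
  "red S t t' \<longleftrightarrow> beta S t t' \<or> rewrite S t t'"

definition joinable :: "('x, 'f, 'h, 'z) sys \<Rightarrow> ('x, 'f, 'h, 'z) trm \<Rightarrow> ('x, 'f, 'h, 'z) trm \<Rightarrow> bool" where
  "joinable S T U \<longleftrightarrow> (\<exists>W. (red S)\<^sup>*\<^sup>* T W \<and> (red S)\<^sup>*\<^sup>* U W)"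


section \<open>Subtyping and typing\<close>

inductive subtype :: "('x, 'f, 'h, 'z) sys \<Rightarrow> ('x, 'f, 'h, 'z) trm \<Rightarrow> ('x, 'f, 'h, 'z) trm \<Rightarrow> bool"
  for S where
  refl: "is_term S T \<Longrightarrow> subtype S T T"
| size: "C \<in> CFBox S \<Longrightarrow> (a, b) \<in> size_le S \<Longrightarrow> \<forall>t \<in> set ts. is_term S t
    \<Longrightarrow> subtype S (foldl App (SSym C a) ts) (foldl App (SSym C b) ts)"
| prod: "subtype S U' U \<Longrightarrow> subtype S V V' \<Longrightarrow> subtype S (prd S x U V) (prd S x U' V')"
| conv: "joinable S T T' \<Longrightarrow> subtype S T' U' \<Longrightarrow> joinable S U' U \<Longrightarrow> subtype S T U"
| trans: "subtype S T U \<Longrightarrow> subtype S U V \<Longrightarrow> subtype S T V"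

text \<open>
  The last declaration of an environment is the head of the list.
  In rule \<open>app\<close>, \<open>is_term S V\<close> excludes the bodies with a dangling index that yield
  the same product.
\<close>

inductive typing :: "('x, 'f, 'h, 'z) sys \<Rightarrow> ('x \<times> ('x, 'f, 'h, 'z) trm) list
    \<Rightarrow> ('x, 'f, 'h, 'z) trm \<Rightarrow> ('x, 'f, 'h, 'z) trm \<Rightarrow> bool" for S where
  ax: "typing S [] (Sort Star) (Sort Box)"
| size: "C \<in> CFBox S \<Longrightarrow> a \<in> sizes S \<Longrightarrow> typing S [] (sym_type S C) (Sort Box)
    \<Longrightarrow> typing S [] (SSym C a) (sym_type S C)"
| symb: "f \<notin> CFBox S \<Longrightarrow> is_size_subst S \<phi> \<Longrightarrow> typing S [] (sym_type S f) (Sort (sym_sort S f))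
    \<Longrightarrow> typing S [] (Sym f) (size_subst \<phi> (sym_type S f))"
| var: "typing S \<Gamma> T (Sort (var_sort S x)) \<Longrightarrow> x \<notin> fst ` set \<Gamma>
    \<Longrightarrow> typing S ((x, T) # \<Gamma>) (FVar x) T"
| weak: "typing S \<Gamma> t T \<Longrightarrow> typing S \<Gamma> U (Sort (var_sort S x)) \<Longrightarrow> x \<notin> fst ` set \<Gamma>
    \<Longrightarrow> typing S ((x, U) # \<Gamma>) t T"
| prod: "typing S \<Gamma> U (Sort s) \<Longrightarrow> typing S ((x, U) # \<Gamma>) V (Sort s')
    \<Longrightarrow> typing S \<Gamma> (prd S x U V) (Sort s')"
| abs: "typing S ((x, U) # \<Gamma>) v V \<Longrightarrow> typing S \<Gamma> (prd S x U V) (Sort s)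
    \<Longrightarrow> typing S \<Gamma> (lam S x U v) (prd S x U V)"
| app: "typing S \<Gamma> t (prd S x U V) \<Longrightarrow> is_term S V \<Longrightarrow> typing S \<Gamma> u U
    \<Longrightarrow> typing S \<Gamma> (App t u) (subst1 x u V)"
| sub: "typing S \<Gamma> t T \<Longrightarrow> typing S \<Gamma> T' (Sort s) \<Longrightarrow> subtype S T T' \<Longrightarrow> typing S \<Gamma> t T'"


section \<open>Standing assumptions\<close>

text \<open>
  Left-hand sides of rules are required to be headed by a symbol; they need not be algebraic,
  and no condition is put on the variables of right-hand sides.
  Renaming of bound variables presupposes infinitely many variables of each sort.
\<close>

locale cacsa =
  fixes S :: "('x, 'f, 'h, 'z) sys"
  assumes infinite_vars: "infinite {x. var_sort S x = s}"
    and type_term: "is_term S (sym_type S f)"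
    and type_closed: "fv (sym_type S f) = {}"
    and type_size_vars: "sym_sort S f = Box \<Longrightarrow> term_size_vars (sym_type S f) = {}"
    and rule_terms: "(l, r) \<in> rules S \<Longrightarrow> is_term S l \<and> is_term S r"
    and rule_head: "(l, r) \<in> rules S \<Longrightarrow> head_symbol l \<noteq> None"
    and rule_size_vars: "(l, r) \<in> rules S \<Longrightarrow> term_size_vars l = {} \<and> term_size_vars r = {}"
    and size_quasi_order: "preorder_on (sizes S) (size_le S)"
    and size_stable: "(a, b) \<in> size_le S \<Longrightarrow> is_size_subst S \<phi>
      \<Longrightarrow> (sexp_subst \<phi> a, sexp_subst \<phi> b) \<in> size_le S"
    and type_typed: "typing S [] (sym_type S f) (Sort (sym_sort S f))"
    and confluent: "confluentp (red S)"
    and rule_typing: "(l, r) \<in> rules S \<Longrightarrow> \<forall>x. is_term S (\<sigma> x)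
      \<Longrightarrow> typing S \<Gamma> (subst \<sigma> l) T \<Longrightarrow> typing S \<Gamma> (subst \<sigma> r) T"

end

theory Submission
  imports Defs
begin

text \<open>
  The crucial point is the injectivity of products with respect to subtyping. A symbol of
  \<open>CFBox\<close> heads no rule, so changing its size annotation in the spine of a term, or below
  products, neither creates nor destroys a redex: this size ordering commutes with reduction.
  With confluence, every subtyping derivation becomes a pair of reductions to terms comparable
  in the size ordering, and reducts of products are products. A $\beta$-redex is then handled
  by inverting the typing of the abstraction, comparing the two product types and substituting.
\<close>

section \<open>Terms with dangling indices\<close>

text \<open>The obstacle is that \<open>subtype\<close> contains \<open>trans\<close> and
  \<open>conv\<close>, whose intermediate terms need not be typable. Typing therefore says nothing
  about them, and products have to be compared on untyped terms; no termination is available either,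
  so confluence must be combined with commutation in both directions of the size ordering. Rules may
  introduce free variables, hence a name that is fresh for a body need not be fresh for its reduct.
  For this reason, and because a product does not determine its bound name, bodies are inverted in
  raw form and compared through their instances by arbitrary terms. Finally, rule \<open>sub\<close>
  demands that its target type be typed. The types of subterms must thus be shown to be typable, and
  for symbols this calls for stability of typing, hence of reduction and subtyping, under size
  substitution.\<close>

primrec opn :: "nat \<Rightarrow> ('x, 'f, 'h, 'z) trm \<Rightarrow> ('x, 'f, 'h, 'z) trm \<Rightarrow> ('x, 'f, 'h, 'z) trm" where
  "opn k u (Sort s) = Sort s"
| "opn k u (FVar y) = FVar y"
| "opn k u (BVar i) = (if i = k then u else BVar i)"
| "opn k u (SSym C a) = SSym C a"
| "opn k u (Sym f) = Sym f"
| "opn k u (Lam s U v) = Lam s (opn k u U) (opn (Suc k) u v)"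
| "opn k u (Prd s U V) = Prd s (opn k u U) (opn (Suc k) u V)"
| "opn k u (App t v) = App (opn k u t) (opn k u v)"

text \<open>A version of \<open>is_term\<close> that recurses on raw constructors and can be
  inverted at a binder, where \<open>lam\<close> and \<open>prd\<close> hide the name used. The
  number bounds the dangling indices; \<open>is_term_iff\<close> identifies level 0 with
  \<open>is_term\<close>.\<close>

primrec wf_at :: "('x, 'f, 'h, 'z) sys \<Rightarrow> nat \<Rightarrow> ('x, 'f, 'h, 'z) trm \<Rightarrow> bool" where
  "wf_at S k (Sort s) = True"
| "wf_at S k (FVar y) = True"
| "wf_at S k (BVar i) = (i < k)"
| "wf_at S k (SSym C a) = (C \<in> CFBox S \<and> a \<in> sizes S)"
| "wf_at S k (Sym f) = (f \<notin> CFBox S)"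
| "wf_at S k (Lam s U v) = (wf_at S k U \<and> wf_at S (Suc k) v)"
| "wf_at S k (Prd s U V) = (wf_at S k U \<and> wf_at S (Suc k) V)"
| "wf_at S k (App t u) = (wf_at S k t \<and> wf_at S k u)"

text \<open>All atoms weigh 0, so that neither opening a body with a variable nor changing size
  annotations alters the measure. Inductions on it may pass from a raw body to an opened
  one.\<close>

primrec height :: "('x, 'f, 'h, 'z) trm \<Rightarrow> nat" where
  "height (Sort s) = 0"
| "height (FVar y) = 0"
| "height (BVar i) = 0"
| "height (SSym C a) = 0"
| "height (Sym f) = 0"
| "height (Lam s U v) = Suc (height U + height v)"
| "height (Prd s U V) = Suc (height U + height V)"
| "height (App t u) = Suc (height t + height u)"

lemma finite_fv [simp]: "finite (fv t)"
  by (induction t) auto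

lemma height_opn_FVar [simp]: "height (opn k (FVar x) t) = height t"
  by (induction t arbitrary: k) auto

lemma close_opn: "x \<notin> fv t \<Longrightarrow> close k x (opn k (FVar x) t) = t"
  by (induction t arbitrary: k) auto

text \<open>Index \<open>k\<close> does not occur in \<open>t\<close>, so its occurrences in the
  closure are exactly the former occurrences of \<open>x\<close>.\<close>

lemma opn_close: "wf_at S k t \<Longrightarrow> opn k u (close k x t) = subst1 x u t"
  by (induction t arbitrary: k) auto

lemma close_fresh: "x \<notin> fv t \<Longrightarrow> close k x t = t"
  by (induction t arbitrary: k) auto

lemma fv_close [simp]: "fv (close k x t) = fv t - {x}"
  by (induction t arbitrary: k) auto

lemma wf_at_close: "wf_at S k t \<Longrightarrow> wf_at S (Suc k) (close k x t)"
  by (induction t arbitrary: k) auto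

lemma wf_at_mono: "wf_at S k t \<Longrightarrow> k \<le> j \<Longrightarrow> wf_at S j t"
proof (induction t arbitrary: k j)
  case (Lam s U v)
  then show ?case by simp (meson Suc_le_mono)
next
  case (Prd s U V)
  then show ?case by simp (meson Suc_le_mono)
qed (simp_all, blast)

lemma opn_wf_at: "wf_at S k t \<Longrightarrow> k \<le> j \<Longrightarrow> opn j u t = t"
proof (induction t arbitrary: k j)
  case (Lam s U v)
  then show ?case by simp (meson Suc_le_mono)
next
  case (Prd s U V)
  then show ?case by simp (meson Suc_le_mono)
qed (auto)

lemma wf_at_opn: "wf_at S (Suc k) t \<Longrightarrow> wf_at S 0 u \<Longrightarrow> wf_at S k (opn k u t)"
  by (induction t arbitrary: k) (auto intro: wf_at_mono)

lemma wf_at_subst: "wf_at S k t \<Longrightarrow> \<forall>x. wf_at S 0 (\<sigma> x) \<Longrightarrow> wf_at S k (subst \<sigma> t)"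
  by (induction t arbitrary: k) (auto intro: wf_at_mono)

lemma subst_opn:
  "\<forall>x. wf_at S 0 (\<sigma> x) \<Longrightarrow> subst \<sigma> (opn k u t) = opn k (subst \<sigma> u) (subst \<sigma> t)"
  by (induction t arbitrary: k) (auto intro!: opn_wf_at[symmetric, of S 0])

lemma subst_subst: "subst \<tau> (subst \<sigma> t) = subst (\<lambda>x. subst \<tau> (\<sigma> x)) t"
  by (induction t) auto

lemma subst_cong: "(\<And>x. x \<in> fv t \<Longrightarrow> \<sigma> x = \<tau> x) \<Longrightarrow> subst \<sigma> t = subst \<tau> t"
  by (induction t) auto

lemma subst_FVar [simp]: "subst FVar t = t"
  by (induction t) auto

lemma subst_upd_fresh: "x \<notin> fv t \<Longrightarrow> subst (\<sigma>(x := u)) t = subst \<sigma> t"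
  by (rule subst_cong) auto

lemma subst1_fresh: "x \<notin> fv t \<Longrightarrow> subst1 x u t = t"
  by (simp add: subst_upd_fresh)

lemma fv_subst: "fv (subst \<sigma> t) = (\<Union>x \<in> fv t. fv (\<sigma> x))"
  by (induction t) auto

text \<open>The condition on \<open>y\<close> prevents capture. It leaves out \<open>x\<close>
  itself, whose image is overwritten.\<close>

lemma subst_close:
  "\<forall>z \<in> fv t - {x}. y \<notin> fv (\<sigma> z) \<Longrightarrow>
    subst \<sigma> (close k x t) = close k y (subst (\<sigma>(x := FVar y)) t)"
  by (induction t arbitrary: k) (auto simp: close_fresh)

lemma subst_lam:
  assumes "\<forall>z \<in> fv v - {x}. y \<notin> fv (\<sigma> z)" "var_sort S y = var_sort S x"
  shows "subst \<sigma> (lam S x U v) = lam S y (subst \<sigma> U) (subst (\<sigma>(x := FVar y)) v)"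
  using assms by (simp add: lam_def subst_close)

lemma subst_prd:
  assumes "\<forall>z \<in> fv v - {x}. y \<notin> fv (\<sigma> z)" "var_sort S y = var_sort S x"
  shows "subst \<sigma> (prd S x U v) = prd S y (subst \<sigma> U) (subst (\<sigma>(x := FVar y)) v)"
  using assms by (simp add: prd_def subst_close)

lemma subst_subst1:
  assumes "\<forall>z \<in> fv v - {x}. y \<notin> fv (\<sigma> z)"
  shows "subst \<sigma> (subst1 x u v) = subst1 y (subst \<sigma> u) (subst (\<sigma>(x := FVar y)) v)"
  unfolding subst_subst using assms by (intro subst_cong) (auto simp: subst_upd_fresh)

lemma is_term_wf_at: "is_term S t \<Longrightarrow> wf_at S 0 t"
  by (induction rule: is_term.induct) (auto simp: lam_def prd_def wf_at_close)

lemma subst1_opn: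
  assumes "wf_at S 0 u" "x \<notin> fv t"
  shows "subst1 x u (opn k (FVar x) t) = opn k u t"
  using subst_opn[of S "FVar(x := u)" k "FVar x" t] assms by (simp add: subst1_fresh)

section \<open>Stability of reduction\<close>

text \<open>What a root relation must satisfy for its context closure to live on terms and to be
  stable under both kinds of substitution. The abstraction lets the same lemmas serve
  \<open>red_root\<close> for subtyping and \<open>beta_root\<close> for the final
  induction.\<close>

definition subst_stable :: "('x, 'f, 'h, 'z) sys
    \<Rightarrow> (('x, 'f, 'h, 'z) trm \<Rightarrow> ('x, 'f, 'h, 'z) trm \<Rightarrow> bool) \<Rightarrow> bool" where
  "subst_stable S P \<longleftrightarrow> (\<forall>t t'. P t t' \<longrightarrow> is_term S t \<and> is_term S t' \<and>
     (\<forall>\<sigma>. (\<forall>x. is_term S (\<sigma> x)) \<longrightarrow> P (subst \<sigma> t) (subst \<sigma> t')) \<and>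
     (\<forall>\<phi>. is_size_subst S \<phi> \<longrightarrow> P (size_subst \<phi> t) (size_subst \<phi> t')))"

section \<open>Size substitutions\<close>

lemma sexp_subst_sizes: "a \<in> sizes S \<Longrightarrow> is_size_subst S \<phi> \<Longrightarrow> sexp_subst \<phi> a \<in> sizes S"
  by (induction rule: sizes.induct) (auto simp: is_size_subst_def intro!: sizes.intros(2))

lemma sexp_subst_sexp_subst:
  "sexp_subst \<psi> (sexp_subst \<phi> a) = sexp_subst (\<lambda>z. sexp_subst \<psi> (\<phi> z)) a"
  by (induction a) auto

lemma size_subst_size_subst:
  "size_subst \<psi> (size_subst \<phi> t) = size_subst (\<lambda>z. sexp_subst \<psi> (\<phi> z)) t"
  by (induction t) (auto simp: sexp_subst_sexp_subst)

lemma sexp_subst_closed: "size_vars a = {} \<Longrightarrow> sexp_subst \<phi> a = a"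
  by (induction a) (auto intro: map_idI)

lemma size_subst_closed: "term_size_vars t = {} \<Longrightarrow> size_subst \<phi> t = t"
  by (induction t) (auto simp: sexp_subst_closed)

lemma size_subst_close: "size_subst \<phi> (close k x t) = close k x (size_subst \<phi> t)"
  by (induction t arbitrary: k) auto

lemma size_subst_lam: "size_subst \<phi> (lam S x U v) = lam S x (size_subst \<phi> U) (size_subst \<phi> v)"
  by (simp add: lam_def size_subst_close)

lemma size_subst_prd: "size_subst \<phi> (prd S x U v) = prd S x (size_subst \<phi> U) (size_subst \<phi> v)"
  by (simp add: prd_def size_subst_close)

lemma size_subst_subst: "size_subst \<phi> (subst \<sigma> t) = subst (\<lambda>x. size_subst \<phi> (\<sigma> x)) (size_subst \<phi> t)"
  by (induction t) auto

lemma size_subst_subst1: "size_subst \<phi> (subst1 x u t) = subst1 x (size_subst \<phi> u) (size_subst \<phi> t)"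
  unfolding size_subst_subst by (intro subst_cong) auto

lemma fv_size_subst [simp]: "fv (size_subst \<phi> t) = fv t"
  by (induction t) auto

lemma is_term_size_subst: "is_term S t \<Longrightarrow> is_size_subst S \<phi> \<Longrightarrow> is_term S (size_subst \<phi> t)"
  by (induction rule: is_term.induct)
    (auto simp: size_subst_lam size_subst_prd sexp_subst_sizes intro: is_term.intros)

lemma head_symbol_subst: "head_symbol t \<noteq> None \<Longrightarrow> head_symbol (subst \<sigma> t) = head_symbol t"
  by (induction t rule: head_symbol.induct) auto

lemma context_closure_is_term:
  assumes "context_closure S P t t'" "subst_stable S P"
  shows "is_term S t \<and> is_term S t'"
  using assms(1)
  by induction (use assms(2) in \<open>auto simp: subst_stable_def intro: is_term.intros\<close>)

lemma context_closure_size_subst: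
  assumes "context_closure S P t t'" "subst_stable S P" "is_size_subst S \<phi>"
  shows "context_closure S P (size_subst \<phi> t) (size_subst \<phi> t')"
  using assms(1)
  by induction
    (use assms(2,3) in \<open>auto simp: subst_stable_def size_subst_lam size_subst_prd
      intro: context_closure.intros is_term_size_subst\<close>)

lemma context_closure_mono:
  "context_closure S P t t' \<Longrightarrow> (\<And>t t'. P t t' \<Longrightarrow> Q t t') \<Longrightarrow> context_closure S Q t t'"
  by (induction rule: context_closure.induct) (auto intro: context_closure.intros)

abbreviation red_root :: "('x, 'f, 'h, 'z) sys \<Rightarrow> ('x, 'f, 'h, 'z) trm \<Rightarrow> ('x, 'f, 'h, 'z) trm \<Rightarrow> bool" where
  "red_root S t t' \<equiv> beta_root S t t' \<or> rule_root S t t'"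

text \<open>A step contracts a single redex, so the union may be taken at the root; afterwards one
  induction covers both kinds of step.\<close>

lemma red_eq_context_closure: "red S = context_closure S (red_root S)"
proof (intro ext iffI)
  fix t t' assume "red S t t'"
  then show "context_closure S (red_root S) t t'"
    unfolding red_def beta_def rewrite_def by (auto intro: context_closure_mono)
next
  fix t t' assume "context_closure S (red_root S) t t'"
  then show "red S t t'"
    unfolding red_def beta_def rewrite_def
    by (induction rule: context_closure.induct) (auto intro: context_closure.intros)
qed

section \<open>Subtyping modulo reduction\<close>

text \<open>
  Contravariance is expressed by inverting the relation \<open>R\<close> on sizes rather than by exchanging
  the two terms. The relation \<open>sle\<close> acts on raw bodies, hence needs no choice of bound names.
\<close>

inductive spine_le :: "('x, 'f, 'h, 'z) sys \<Rightarrow> ('h, 'z) sexp rel \<Rightarrow> ('x, 'f, 'h, 'z) trm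
    \<Rightarrow> ('x, 'f, 'h, 'z) trm \<Rightarrow> bool" for S R where
  sym: "C \<in> CFBox S \<Longrightarrow> (a, b) \<in> R \<Longrightarrow> spine_le S R (SSym C a) (SSym C b)"
| app: "spine_le S R t t' \<Longrightarrow> spine_le S R (App t u) (App t' u)"

inductive sle :: "('x, 'f, 'h, 'z) sys \<Rightarrow> ('h, 'z) sexp rel \<Rightarrow> ('x, 'f, 'h, 'z) trm
    \<Rightarrow> ('x, 'f, 'h, 'z) trm \<Rightarrow> bool" for S where
  refl: "sle S R t t"
| spine: "spine_le S R t t' \<Longrightarrow> sle S R t t'"
| prod: "sle S (R\<inverse>) U U' \<Longrightarrow> sle S R B B' \<Longrightarrow> sle S R (Prd s U B) (Prd s U' B')"

inductive_cases spine_le_SSymE: "spine_le S R (SSym C a) u"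
inductive_cases spine_le_AppE: "spine_le S R (App t v) u"
inductive_cases spine_le_LamE: "spine_le S R (Lam s U v) u"
inductive_cases spine_le_PrdE: "spine_le S R (Prd s U v) u"
inductive_cases spine_le_to_PrdE: "spine_le S R u (Prd s U v)"
inductive_cases sle_PrdE: "sle S R (Prd s U B) W"

lemma sle_Prd:
  "sle S R (Prd s U B) W \<Longrightarrow> \<exists>U' B'. W = Prd s U' B' \<and> sle S (R\<inverse>) U U' \<and> sle S R B B'"
  by (erule sle_PrdE) (auto elim: spine_le_PrdE intro: sle.refl)

lemma spine_le_converse: "spine_le S R t u \<Longrightarrow> spine_le S (R\<inverse>) u t"
  by (induction rule: spine_le.induct) (auto intro: spine_le.intros)

lemma sle_converse: "sle S R t u \<Longrightarrow> sle S (R\<inverse>) u t"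
  by (induction rule: sle.induct) (auto intro: sle.intros spine_le_converse)

lemma spine_le_trans: "spine_le S R t u \<Longrightarrow> spine_le S R u w \<Longrightarrow> trans R \<Longrightarrow> spine_le S R t w"
  by (induction arbitrary: w rule: spine_le.induct)
    (auto elim!: spine_le_SSymE spine_le_AppE intro: spine_le.intros dest: transD)

lemma sle_trans: "sle S R t u \<Longrightarrow> sle S R u w \<Longrightarrow> trans R \<Longrightarrow> sle S R t w"
proof (induction arbitrary: w rule: sle.induct)
  case (spine R t t')
  \<comment> \<open>A term headed by an annotated symbol is not a product, so only
    \<open>refl\<close> or another \<open>spine\<close> can follow.\<close>
  from spine.prems(1) show ?case
    by (cases rule: sle.cases)
      (use spine in \<open>auto intro: sle.spine dest: spine_le_trans elim: spine_le_to_PrdE\<close>)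
next
  case (prod R U U' B B' s)
  then show ?case by (auto dest!: sle_Prd intro!: sle.prod)
qed

lemma spine_le_opn: "spine_le S R t u \<Longrightarrow> spine_le S R (opn k w t) (opn k w u)"
  by (induction rule: spine_le.induct) (auto intro: spine_le.intros)

lemma sle_opn: "sle S R t u \<Longrightarrow> sle S R (opn k w t) (opn k w u)"
  by (induction arbitrary: k rule: sle.induct) (auto intro: sle.intros spine_le_opn)

lemma spine_le_close: "spine_le S R t u \<Longrightarrow> spine_le S R (close k x t) (close k x u)"
  by (induction rule: spine_le.induct) (auto intro: spine_le.intros)

lemma sle_close: "sle S R t u \<Longrightarrow> sle S R (close k x t) (close k x u)"
  by (induction arbitrary: k rule: sle.induct) (auto intro: sle.intros spine_le_close)

lemma spine_le_head: "spine_le S R t u \<Longrightarrow> \<exists>C \<in> CFBox S. head_symbol t = Some C"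
  by (induction rule: spine_le.induct) auto

lemma spine_le_foldl:
  assumes "C \<in> CFBox S" "(a, b) \<in> R"
  shows "spine_le S R (foldl App (SSym C a) ts) (foldl App (SSym C b) ts)"
  using assms by (induction ts rule: rev_induct) (auto intro: spine_le.intros)

lemma subst_foldl_App: "subst \<sigma> (foldl App t ts) = foldl App (subst \<sigma> t) (map (subst \<sigma>) ts)"
  by (induction ts arbitrary: t) auto

lemma size_subst_foldl_App:
  "size_subst \<phi> (foldl App t ts) = foldl App (size_subst \<phi> t) (map (size_subst \<phi>) ts)"
  by (induction ts arbitrary: t) auto

context cacsa
begin

section \<open>Raw and named terms, and reduction under substitution\<close>

lemma fresh_var:
  assumes "finite A"
  obtains y where "y \<notin> A" "var_sort S y = s"
  using infinite_vars[of s] assms by (metis (mono_tags, lifting) finite_subset mem_Collect_eq subsetI)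

text \<open>A raw body has a dangling index and is no term; it is opened with a fresh variable of
  the recorded sort before the induction hypothesis applies. The opened body is not a subterm,
  whence the induction on \<open>height\<close>.\<close>

lemma wf_at_is_term: "wf_at S 0 t \<Longrightarrow> is_term S t"
proof (induction "height t" arbitrary: t rule: less_induct)
  case less
  have *: "\<exists>x v. var_sort S x = s \<and> B = close 0 x v \<and> is_term S v"
    if "height B < height t" "wf_at S (Suc 0) B" for B s
  proof -
    obtain x where "x \<notin> fv B" "var_sort S x = s" using fresh_var[of "fv B"] by auto
    then show ?thesis
      using less.hyps[of "opn 0 (FVar x) B"] that close_opn[of x B 0] wf_at_opn[of S 0 B "FVar x"]
      by (metis height_opn_FVar wf_at.simps(2))
  qed
  show ?case
  proof (cases t)
    case (Lam s U B)
    then obtain x v where "var_sort S x = s" "B = close 0 x v" "is_term S v"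
      using *[of B s] less.prems by auto
    then have "t = lam S x U v" "is_term S U" using Lam less by (auto simp: lam_def)
    then show ?thesis using \<open>is_term S v\<close> by (auto intro: is_term.intros)
  next
    case (Prd s U B)
    then obtain x v where "var_sort S x = s" "B = close 0 x v" "is_term S v"
      using *[of B s] less.prems by auto
    then have "t = prd S x U v" "is_term S U" using Prd less by (auto simp: prd_def)
    then show ?thesis using \<open>is_term S v\<close> by (auto intro: is_term.intros)
  qed (use less in \<open>auto intro: is_term.intros\<close>)
qed

lemma is_term_iff: "is_term S t \<longleftrightarrow> wf_at S 0 t"
  using is_term_wf_at wf_at_is_term by blast

lemma is_term_subst: "is_term S t \<Longrightarrow> \<forall>x. is_term S (\<sigma> x) \<Longrightarrow> is_term S (subst \<sigma> t)"
  by (simp add: is_term_iff wf_at_subst)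

lemma is_term_upd: "\<forall>x. is_term S (\<sigma> x) \<Longrightarrow> is_term S u \<Longrightarrow> \<forall>z. is_term S ((\<sigma>(x := u)) z)"
  by auto

lemma is_term_FVar_upd: "is_term S u \<Longrightarrow> \<forall>z. is_term S ((FVar(x := u)) z)"
  by (simp add: is_term.intros(2))

lemma is_term_Prd:
  "is_term S (Prd s U B) \<longleftrightarrow> is_term S U \<and> wf_at S (Suc 0) B"
  by (simp add: is_term_iff)

lemma is_term_opn: "wf_at S (Suc 0) B \<Longrightarrow> is_term S u \<Longrightarrow> is_term S (opn 0 u B)"
  by (simp add: is_term_iff wf_at_opn)

lemma fresh_for_subst:
  assumes "finite A" "finite F"
  obtains y where "y \<notin> A" "\<forall>z \<in> F. y \<notin> fv (\<sigma> z)" "var_sort S y = s"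
proof -
  have "finite (A \<union> (\<Union>z \<in> F. fv (\<sigma> z)))" using assms by simp
  then obtain y where "y \<notin> A \<union> (\<Union>z \<in> F. fv (\<sigma> z))" "var_sort S y = s"
    by (rule fresh_var)
  then show ?thesis using that by blast
qed

lemma context_closure_subst:
  assumes "context_closure S P t t'" "subst_stable S P" "\<forall>x. is_term S (\<sigma> x)"
  shows "context_closure S P (subst \<sigma> t) (subst \<sigma> t')"
  using assms(1,3)
proof (induction arbitrary: \<sigma> rule: context_closure.induct)
  case (root t t')
  then show ?case using assms(2) by (auto simp: subst_stable_def intro: context_closure.root)
next
  case (lamL U U' v x)
  obtain y where y: "\<forall>z \<in> fv v. y \<notin> fv (\<sigma> z)" "var_sort S y = var_sort S x"
    using fresh_for_subst[of "{}" "fv v" \<sigma>] by auto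
  then show ?case using lamL
    by (auto simp: subst_lam[of v x y] intro!: context_closure.lamL is_term_subst is_term.intros)
next
  case (lamR U v v' x)
  \<comment> \<open>The reduct \<open>v'\<close> may have free variables that \<open>v\<close>
    lacks, so \<open>y\<close> must avoid the images of both.\<close>
  obtain y where y: "\<forall>z \<in> fv v \<union> fv v'. y \<notin> fv (\<sigma> z)" "var_sort S y = var_sort S x"
    using fresh_for_subst[of "{}" "fv v \<union> fv v'" \<sigma>] by (metis finite.emptyI finite_Un finite_fv)
  have "context_closure S P (subst (\<sigma>(x := FVar y)) v) (subst (\<sigma>(x := FVar y)) v')"
    by (rule lamR.IH[OF is_term_upd[OF lamR.prems is_term.intros(2)]])
  then show ?case
    using y lamR.hyps lamR.prems
    by (auto simp: subst_lam[of _ x y] intro!: context_closure.lamR is_term_subst)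
next
  case (prdL U U' v x)
  obtain y where y: "\<forall>z \<in> fv v. y \<notin> fv (\<sigma> z)" "var_sort S y = var_sort S x"
    using fresh_for_subst[of "{}" "fv v" \<sigma>] by auto
  then show ?case using prdL
    by (auto simp: subst_prd[of v x y] intro!: context_closure.prdL is_term_subst is_term.intros)
next
  case (prdR U v v' x)
  obtain y where y: "\<forall>z \<in> fv v \<union> fv v'. y \<notin> fv (\<sigma> z)" "var_sort S y = var_sort S x"
    using fresh_for_subst[of "{}" "fv v \<union> fv v'" \<sigma>] by (metis finite.emptyI finite_Un finite_fv)
  have "context_closure S P (subst (\<sigma>(x := FVar y)) v) (subst (\<sigma>(x := FVar y)) v')"
    by (rule prdR.IH[OF is_term_upd[OF prdR.prems is_term.intros(2)]])
  then show ?case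
    using y prdR.hyps prdR.prems
    by (auto simp: subst_prd[of _ x y] intro!: context_closure.prdR is_term_subst)
qed (auto intro: context_closure.intros is_term_subst)

lemma stable_beta_root: "subst_stable S (beta_root S)"
  unfolding subst_stable_def
proof (intro allI impI)
  fix t t' assume "beta_root S t t'"
  then obtain x U v u where eq: "t = App (lam S x U v) u" "t' = subst1 x u v"
    and trm: "is_term S U" "is_term S v" "is_term S u"
    by (auto elim: beta_root.cases)
  have "beta_root S (subst \<sigma> t) (subst \<sigma> t')" if s: "\<forall>x. is_term S (\<sigma> x)" for \<sigma>
  proof -
    obtain y where y: "\<forall>z \<in> fv v. y \<notin> fv (\<sigma> z)" "var_sort S y = var_sort S x"
      using fresh_for_subst[of "{}" "fv v" \<sigma>] by auto
    then show ?thesis using s trm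
      by (auto simp: eq subst_lam[of v x y] subst_subst1[of v x y]
          intro!: beta_root.intros is_term_subst is_term.intros)
  qed
  moreover have "beta_root S (size_subst \<phi> t) (size_subst \<phi> t')" if "is_size_subst S \<phi>" for \<phi>
    using that trm by (auto simp: eq size_subst_lam size_subst_subst1
        intro!: beta_root.intros is_term_size_subst)
  ultimately show "is_term S t \<and> is_term S t' \<and>
     (\<forall>\<sigma>. (\<forall>x. is_term S (\<sigma> x)) \<longrightarrow> beta_root S (subst \<sigma> t) (subst \<sigma> t')) \<and>
     (\<forall>\<phi>. is_size_subst S \<phi> \<longrightarrow> beta_root S (size_subst \<phi> t) (size_subst \<phi> t'))"
    using trm is_term_FVar_upd[of u x] by (auto simp: eq intro!: is_term_subst intro: is_term.intros)
qed

text \<open>The two sides of a rule contain no size variables, so a size substitution acts only on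
  the matching substitution.\<close>

lemma stable_rule_root: "subst_stable S (rule_root S)"
  unfolding subst_stable_def
proof (intro allI impI)
  fix t t' assume "rule_root S t t'"
  then obtain l r \<tau> where eq: "t = subst \<tau> l" "t' = subst \<tau> r"
    and lr: "(l, r) \<in> rules S" and \<tau>: "\<forall>x. is_term S (\<tau> x)"
    by (auto elim: rule_root.cases)
  have "rule_root S (subst \<sigma> t) (subst \<sigma> t')" if "\<forall>x. is_term S (\<sigma> x)" for \<sigma>
    unfolding eq subst_subst using lr \<tau> that by (auto intro!: rule_root.intros is_term_subst)
  moreover have "rule_root S (size_subst \<phi> t) (size_subst \<phi> t')" if "is_size_subst S \<phi>" for \<phi>
    unfolding eq size_subst_subst using lr \<tau> that rule_size_vars[OF lr]
    by (auto simp: size_subst_closed intro!: rule_root.intros is_term_size_subst)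
  ultimately show "is_term S t \<and> is_term S t' \<and>
     (\<forall>\<sigma>. (\<forall>x. is_term S (\<sigma> x)) \<longrightarrow> rule_root S (subst \<sigma> t) (subst \<sigma> t')) \<and>
     (\<forall>\<phi>. is_size_subst S \<phi> \<longrightarrow> rule_root S (size_subst \<phi> t) (size_subst \<phi> t'))"
    using rule_terms[OF lr] \<tau> by (auto simp: eq intro: is_term_subst)
qed

lemma stable_red_root: "subst_stable S (red_root S)"
  using stable_beta_root stable_rule_root unfolding subst_stable_def by blast

lemma red_is_term: "red S t t' \<Longrightarrow> is_term S t \<and> is_term S t'"
  unfolding red_eq_context_closure by (rule context_closure_is_term[OF _ stable_red_root])

lemma red_subst: "red S t t' \<Longrightarrow> \<forall>x. is_term S (\<sigma> x) \<Longrightarrow> red S (subst \<sigma> t) (subst \<sigma> t')"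
  unfolding red_eq_context_closure by (rule context_closure_subst[OF _ stable_red_root])

lemma red_size_subst: "red S t t' \<Longrightarrow> is_size_subst S \<phi> \<Longrightarrow> red S (size_subst \<phi> t) (size_subst \<phi> t')"
  unfolding red_eq_context_closure by (rule context_closure_size_subst[OF _ stable_red_root])

text \<open>The derivation reduces the body under some unknown name \<open>x\<close>. Stability
  under substitution of \<open>u\<close> for \<open>x\<close> turns this into a step between the
  openings by any \<open>u\<close>, which no longer mention that name.\<close>

lemma context_closure_Prd_cases:
  assumes "context_closure S P (Prd s U B) W" "subst_stable S P" "\<not> P (Prd s U B) W"
  obtains (dom) U' where "W = Prd s U' B" "context_closure S P U U'"
    | (body) B' where "W = Prd s U B'"
        "\<And>u. is_term S u \<Longrightarrow> context_closure S P (opn 0 u B) (opn 0 u B')"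
  using assms(1)
proof (cases rule: context_closure.cases)
  case (prdR U' v v' x)
  then have eq: "B = close 0 x v" "W = Prd s U (close 0 x v')" "s = var_sort S x"
    by (auto simp: prd_def)
  have "context_closure S P (opn 0 u B) (opn 0 u (close 0 x v'))" if "is_term S u" for u
    using context_closure_subst[OF prdR(4) assms(2), of "FVar(x := u)"] is_term_FVar_upd[OF that, of x]
      context_closure_is_term[OF prdR(4) assms(2)]
    by (simp add: eq opn_close[of S] is_term_iff)
  then show ?thesis using body eq prdR by blast
next
  case root
  then show ?thesis using assms(3) by simp
next
  case (prdL U1 U' v x)
  then show ?thesis using dom[of U'] by (simp add: prd_def)
qed (simp_all add: lam_def prd_def)

lemma context_closure_Lam_cases:
  assumes "context_closure S P (Lam s U B) W" "subst_stable S P" "\<not> P (Lam s U B) W"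
  obtains (dom) U' where "W = Lam s U' B" "context_closure S P U U'"
    | (body) B' where "W = Lam s U B'"
        "\<And>u. is_term S u \<Longrightarrow> context_closure S P (opn 0 u B) (opn 0 u B')"
  using assms(1)
proof (cases rule: context_closure.cases)
  case (lamR U' v v' x)
  then have eq: "B = close 0 x v" "W = Lam s U (close 0 x v')" "s = var_sort S x"
    by (auto simp: lam_def)
  have "context_closure S P (opn 0 u B) (opn 0 u (close 0 x v'))" if "is_term S u" for u
    using context_closure_subst[OF lamR(4) assms(2), of "FVar(x := u)"] is_term_FVar_upd[OF that, of x]
      context_closure_is_term[OF lamR(4) assms(2)]
    by (simp add: eq opn_close[of S] is_term_iff)
  then show ?thesis using body eq lamR by blast
next
  case root
  then show ?thesis using assms(3) by simp
next
  case (lamL U1 U' v x)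
  then show ?thesis using dom[of U'] by (simp add: lam_def)
qed (simp_all add: lam_def prd_def)

text \<open>A beta-redex is headed by an abstraction and has no head symbol, while an instance of a
  left-hand side keeps the head symbol of that side, which is not in \<open>CFBox S\<close>.\<close>

lemma not_red_root_CFBox:
  assumes "C \<in> CFBox S" "head_symbol t = Some C"
  shows "\<not> red_root S t t'"
proof
  assume "red_root S t t'"
  then show False
  proof
    assume "beta_root S t t'"
    then show False using assms by (auto elim!: beta_root.cases simp: lam_def)
  next
    assume "rule_root S t t'"
    then obtain l r \<sigma> where "t = subst \<sigma> l" "(l, r) \<in> rules S" by (auto elim: rule_root.cases)
    then show False
      using assms rule_head[of l r] head_symbol_subst[of l \<sigma>] by (auto simp: CFBox_def)
  qed
qed

lemma not_red_root_Prd: "\<not> red_root S (Prd s U B) t'"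
proof
  assume "red_root S (Prd s U B) t'"
  then show False
  proof
    assume "beta_root S (Prd s U B) t'"
    then show False by (auto elim: beta_root.cases)
  next
    assume "rule_root S (Prd s U B) t'"
    then obtain l r \<sigma> where "Prd s U B = subst \<sigma> l" "(l, r) \<in> rules S"
      by (auto elim: rule_root.cases)
    then show False using rule_head[of l r] head_symbol_subst[of l \<sigma>]
      by (metis head_symbol.simps(8))
  qed
qed

section \<open>Commutation of reduction with the size ordering\<close>

lemma red_appL: "red S t t' \<Longrightarrow> is_term S u \<Longrightarrow> red S (App t u) (App t' u)"
  by (simp add: red_eq_context_closure context_closure.appL)

lemma red_appR: "is_term S t \<Longrightarrow> red S u u' \<Longrightarrow> red S (App t u) (App t u')"
  by (simp add: red_eq_context_closure context_closure.appR)

lemma red_lamL: "red S U U' \<Longrightarrow> is_term S v \<Longrightarrow> red S (lam S x U v) (lam S x U' v)"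
  by (simp add: red_eq_context_closure context_closure.lamL)

lemma red_lamR: "is_term S U \<Longrightarrow> red S v v' \<Longrightarrow> red S (lam S x U v) (lam S x U v')"
  by (simp add: red_eq_context_closure context_closure.lamR)

lemma red_prdL: "red S U U' \<Longrightarrow> is_term S V \<Longrightarrow> red S (prd S x U V) (prd S x U' V)"
  by (simp add: red_eq_context_closure context_closure.prdL)

lemma red_prdR: "is_term S U \<Longrightarrow> red S V V' \<Longrightarrow> red S (prd S x U V) (prd S x U V')"
  by (simp add: red_eq_context_closure context_closure.prdR)

lemma prd_eq_Prd_opn: "x \<notin> fv B \<Longrightarrow> var_sort S x = s \<Longrightarrow> Prd s U B = prd S x U (opn 0 (FVar x) B)"
  by (simp add: prd_def close_opn)

text \<open>No prefix of the spine is a redex, so the step lies in one of the arguments, and these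
  are shared by both terms.\<close>

lemma red_spine_le:
  assumes "red S t t'" "spine_le S R t u" "is_term S u"
  shows "\<exists>u'. red S u u' \<and> spine_le S R t' u'"
  using assms unfolding red_eq_context_closure
proof (induction arbitrary: u rule: context_closure.induct)
  case (root t t')
  then show ?case using spine_le_head[OF root.prems(1)] not_red_root_CFBox by blast
next
  case (appL t t' v)
  then obtain t2 where "u = App t2 v" "spine_le S R t t2" by (auto elim: spine_le_AppE)
  moreover have "is_term S t2" using calculation(1) appL.prems(2) by (simp add: is_term_iff)
  ultimately show ?case using appL.IH[of t2] appL.hyps
    by (blast intro: spine_le.app context_closure.appL)
next
  case (appR t v v')
  then obtain t2 where "u = App t2 v" "spine_le S R t t2" by (auto elim: spine_le_AppE)
  moreover have "is_term S t2" using calculation(1) appR.prems(2) by (simp add: is_term_iff)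
  ultimately show ?case using appR.hyps
    by (blast intro: spine_le.app context_closure.appR)
qed (auto simp: lam_def prd_def elim: spine_le_LamE spine_le_PrdE)

text \<open>One step is matched by one step, so the many-step version needs no confluence.
  Generality in \<open>R\<close> is essential: the domains of products use
  \<open>R\<inverse>\<close>, and the mirror statement \<open>reds_sle_right\<close> follows by
  inverting \<open>R\<close>. Induction is on \<open>height\<close> because bodies are
  opened.\<close>

lemma red_sle:
  assumes "red S t t'" "sle S R t u" "is_term S u"
  shows "\<exists>u'. red S u u' \<and> sle S R t' u'"
  using assms
proof (induction "height t" arbitrary: t t' u R rule: less_induct)
  case less
  from less.prems(2) show ?case
  proof (cases rule: sle.cases)
    case refl
    then show ?thesis using less.prems(1) by (auto intro: sle.refl)
  next
    case spine
    then show ?thesis using red_spine_le[OF less.prems(1) _ less.prems(3)] by (auto intro: sle.spine)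
  next
    case (prod U U' B B' s)
    from prod(1) less.prems(1) have "context_closure S (red_root S) (Prd s U B) t'"
      by (simp add: red_eq_context_closure)
    from this stable_red_root not_red_root_Prd show ?thesis
    proof (cases rule: context_closure_Prd_cases)
      case (dom U1)
      then obtain U2 where U2: "red S U' U2" "sle S (R\<inverse>) U1 U2"
        using less.hyps[of U U1 "R\<inverse>" U'] prod less.prems(3)
        by (auto simp: red_eq_context_closure is_term_Prd)
      obtain x where x: "x \<notin> fv B'" "var_sort S x = s" using fresh_var[of "fv B'" s] by auto
      have "is_term S (opn 0 (FVar x) B')"
        using less.prems(3) prod by (auto simp: is_term_Prd intro: is_term_opn is_term.intros)
      then have "red S u (Prd s U2 B')"
        using red_prdL[OF U2(1)] x prod prd_eq_Prd_opn[of x B' s] by simp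
      then show ?thesis using U2 dom prod by (auto intro: sle.prod)
    next
      case (body B1)
      \<comment> \<open>Freshness for \<open>B1\<close> is a separate demand, since the step may
        have introduced free variables; it allows \<open>B1\<close> to be recovered by
        closing.\<close>
      obtain x where x: "x \<notin> fv B \<union> fv B1 \<union> fv B'" "var_sort S x = s"
        using fresh_var[of "fv B \<union> fv B1 \<union> fv B'" s] by auto
      let ?o = "opn 0 (FVar x)"
      have "red S (?o B) (?o B1)"
        using body(2)[of "FVar x"] by (simp add: red_eq_context_closure is_term.intros)
      moreover have "is_term S (?o B')"
        using less.prems(3) prod by (auto simp: is_term_Prd intro: is_term_opn is_term.intros)
      ultimately obtain V where V: "red S (?o B') V" "sle S R (?o B1) V"
        using less.hyps[of "?o B" "?o B1" R "?o B'"] prod by (auto intro: sle_opn)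
      have "red S (prd S x U' (?o B')) (prd S x U' V)"
        using V(1) less.prems(3) prod by (intro red_prdR) (auto simp: is_term_Prd)
      then have "red S u (Prd s U' (close 0 x V))"
        using x prod by (simp add: prd_def close_opn)
      moreover have "sle S R B1 (close 0 x V)"
        using sle_close[OF V(2), of 0 x] x by (simp add: close_opn)
      ultimately show ?thesis using body prod by (auto intro: sle.prod)
    qed
  qed
qed

lemma reds_is_term: "(red S)\<^sup>*\<^sup>* t t' \<Longrightarrow> is_term S t \<longleftrightarrow> is_term S t'"
  by (induction rule: rtranclp_induct) (auto dest: red_is_term)

lemma reds_sle:
  assumes "(red S)\<^sup>*\<^sup>* t t'" "sle S R t u" "is_term S u"
  shows "\<exists>u'. (red S)\<^sup>*\<^sup>* u u' \<and> sle S R t' u'"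
  using assms
proof (induction rule: rtranclp_induct)
  case (step t1 t2)
  then obtain u1 where "(red S)\<^sup>*\<^sup>* u u1" "sle S R t1 u1" by auto
  then show ?case using red_sle[OF step.hyps(2), of R u1] step.prems(2) reds_is_term
    by (meson rtranclp.rtrancl_into_rtrancl)
qed auto

lemma reds_sle_right:
  assumes "(red S)\<^sup>*\<^sup>* u u'" "sle S R t u" "is_term S t"
  shows "\<exists>t'. (red S)\<^sup>*\<^sup>* t t' \<and> sle S R t' u'"
  using reds_sle[OF assms(1) sle_converse[OF assms(2)] assms(3)] sle_converse
  by (metis converse_converse)

lemma reds_confluent: "(red S)\<^sup>*\<^sup>* x y \<Longrightarrow> (red S)\<^sup>*\<^sup>* x z \<Longrightarrow> \<exists>u. (red S)\<^sup>*\<^sup>* y u \<and> (red S)\<^sup>*\<^sup>* z u"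
  using confluentpD[OF confluent] .

section \<open>Subtyping as reduction followed by size comparison\<close>

lemma spine_le_subtype:
  assumes "spine_le S (size_le S) t u" "is_term S t"
  shows "subtype S t u"
proof -
  from assms have "\<exists>C a b ts. t = foldl App (SSym C a) ts \<and> u = foldl App (SSym C b) ts \<and>
      C \<in> CFBox S \<and> (a, b) \<in> size_le S \<and> (\<forall>t \<in> set ts. is_term S t)"
  proof (induction rule: spine_le.induct)
    case (sym C a b)
    then show ?case by (metis empty_iff foldl_Nil list.set(1))
  next
    case (app t t' v)
    then obtain C a b ts where *: "t = foldl App (SSym C a) ts" "t' = foldl App (SSym C b) ts"
      "C \<in> CFBox S" "(a, b) \<in> size_le S" "\<forall>t \<in> set ts. is_term S t" "is_term S v"
      by (auto simp: is_term_iff)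
    then have "App t v = foldl App (SSym C a) (ts @ [v])" "App t' v = foldl App (SSym C b) (ts @ [v])"
      "\<forall>t \<in> set (ts @ [v]). is_term S t"
      by auto
    then show ?case using * by blast
  qed
  then show ?thesis by (auto intro: subtype.size)
qed

lemma spine_le_height: "spine_le S R t u \<Longrightarrow> height u = height t"
  by (induction rule: spine_le.induct) auto

lemma sle_height: "sle S R t u \<Longrightarrow> height u = height t"
  by (induction rule: sle.induct) (auto simp: spine_le_height)

lemma sle_subtype:
  assumes "sle S (size_le S) t u" "is_term S t" "is_term S u"
  shows "subtype S t u"
  using assms
proof (induction "height t" arbitrary: t u rule: less_induct)
  case less
  from less.prems(1) show ?case
  proof (cases rule: sle.cases)
    case refl
    then show ?thesis using less.prems by (auto intro: subtype.refl)
  next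
    case spine
    then show ?thesis using less.prems by (auto intro: spine_le_subtype)
  next
    case (prod U U' B B' s)
    obtain x where x: "x \<notin> fv B \<union> fv B'" "var_sort S x = s"
      using fresh_var[of "fv B \<union> fv B'" s] by auto
    let ?o = "opn 0 (FVar x)"
    \<comment> \<open>The statement fixes \<open>size_le S\<close>, so contravariance exchanges the
      two domains, and \<open>U'\<close> becomes the left-hand term whose height must
      decrease.\<close>
    have "height U' = height U" using prod sle_height by blast
    then have "subtype S U' U"
      using less.hyps[of U' U] less.prems prod sle_converse[OF prod(3)] by (auto simp: is_term_Prd)
    moreover have "subtype S (?o B) (?o B')"
      using less.hyps[of "?o B" "?o B'"] less.prems prod
      by (auto simp: is_term_Prd intro!: sle_opn is_term_opn intro: is_term.intros)
    ultimately show ?thesis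
      using x prod subtype.prod[of S U' U "?o B" "?o B'" x]
        prd_eq_Prd_opn[of x B s U] prd_eq_Prd_opn[of x B' s U'] by simp
  qed
qed

lemma reds_prd:
  assumes "(red S)\<^sup>*\<^sup>* U U'" "(red S)\<^sup>*\<^sup>* V V'" "is_term S U" "is_term S V"
  shows "(red S)\<^sup>*\<^sup>* (prd S x U V) (prd S x U' V')"
proof -
  from assms(1) have "(red S)\<^sup>*\<^sup>* (prd S x U V) (prd S x U' V)"
    by (induction rule: rtranclp_induct)
      (use assms(4) in \<open>auto intro: rtranclp.rtrancl_into_rtrancl red_prdL\<close>)
  moreover have "is_term S U'" using assms reds_is_term by blast
  with assms(2) have "(red S)\<^sup>*\<^sup>* (prd S x U' V) (prd S x U' V')"
    by (induction rule: rtranclp_induct) (auto intro: rtranclp.rtrancl_into_rtrancl red_prdR)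
  ultimately show ?thesis by simp
qed

lemma trans_size_le: "trans (size_le S)"
  using size_quasi_order by (simp add: preorder_on_def)

lemma size_le_sizes: "(a, b) \<in> size_le S \<Longrightarrow> a \<in> sizes S \<and> b \<in> sizes S"
  using size_quasi_order by (auto simp: preorder_on_def)

lemma is_term_foldl_App:
  "is_term S (foldl App t ts) \<longleftrightarrow> is_term S t \<and> (\<forall>u \<in> set ts. is_term S u)"
  by (induction ts arbitrary: t) (auto simp: is_term_iff)

lemma subtype_imp_reds_sle:
  assumes "subtype S T U"
  shows "is_term S T \<and> is_term S U \<and>
    (\<exists>T' U'. (red S)\<^sup>*\<^sup>* T T' \<and> (red S)\<^sup>*\<^sup>* U U' \<and> sle S (size_le S) T' U')"
  using assms
proof (induction rule: subtype.induct)
  case (refl T)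
  then show ?case by (auto intro: sle.refl)
next
  case (size C a b ts)
  then show ?case using spine_le_foldl[of C S a b "size_le S" ts] size_le_sizes[of a b]
    by (auto simp: is_term_foldl_App intro: sle.spine is_term.intros)
next
  case (prod U' U V V' x)
  then obtain U1' U1 V1 V1' where *: "(red S)\<^sup>*\<^sup>* U' U1'" "(red S)\<^sup>*\<^sup>* U U1" "sle S (size_le S) U1' U1"
    "(red S)\<^sup>*\<^sup>* V V1" "(red S)\<^sup>*\<^sup>* V' V1'" "sle S (size_le S) V1 V1'" by blast
  have "sle S (size_le S) (prd S x U1 V1) (prd S x U1' V1')"
    unfolding prd_def using * by (intro sle.prod sle_converse sle_close)
  then show ?case using prod.IH * reds_prd by (blast intro: is_term.intros)
next
  case (conv T T' U' U)
  then obtain W Z T1 U1 where *: "(red S)\<^sup>*\<^sup>* T W" "(red S)\<^sup>*\<^sup>* T' W" "(red S)\<^sup>*\<^sup>* U' Z" "(red S)\<^sup>*\<^sup>* U Z"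
    "(red S)\<^sup>*\<^sup>* T' T1" "(red S)\<^sup>*\<^sup>* U' U1" "sle S (size_le S) T1 U1"
    unfolding joinable_def by blast
  have trm: "is_term S W" "is_term S Z" "is_term S T1" "is_term S U1" "is_term S T" "is_term S U"
    using conv.IH * reds_is_term by metis+
  \<comment> \<open>Chase along the zigzag \<open>T\<close>, \<open>W\<close>, \<open>T'\<close>,
    \<open>T1\<close>, \<open>U1\<close>, \<open>U'\<close>, \<open>Z\<close>, \<open>U\<close>:
    confluence at \<open>T'\<close> gives \<open>X\<close>, commutation carries it right to
    \<open>Y\<close>, confluence at \<open>U'\<close> gives \<open>Y'\<close>, and commutation
    carries that back left to \<open>X'\<close>.\<close>
  obtain X where X: "(red S)\<^sup>*\<^sup>* W X" "(red S)\<^sup>*\<^sup>* T1 X" using reds_confluent * by blast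
  obtain Y where Y: "(red S)\<^sup>*\<^sup>* U1 Y" "sle S (size_le S) X Y" using reds_sle[OF X(2)] * trm by blast
  obtain Y' where Y': "(red S)\<^sup>*\<^sup>* Y Y'" "(red S)\<^sup>*\<^sup>* Z Y'"
    using reds_confluent[of U' Y Z] Y * by (meson rtranclp_trans)
  obtain X' where X': "(red S)\<^sup>*\<^sup>* X X'" "sle S (size_le S) X' Y'"
    using reds_sle_right[OF Y'(1) Y(2)] X trm reds_is_term by blast
  have "(red S)\<^sup>*\<^sup>* T X'" "(red S)\<^sup>*\<^sup>* U Y'" using * X X' Y' by (meson rtranclp_trans)+
  then show ?case using X' trm by blast
next
  case (trans T U V)
  then obtain T1 U1 U2 V2 where *: "(red S)\<^sup>*\<^sup>* T T1" "(red S)\<^sup>*\<^sup>* U U1" "sle S (size_le S) T1 U1"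
    "(red S)\<^sup>*\<^sup>* U U2" "(red S)\<^sup>*\<^sup>* V V2" "sle S (size_le S) U2 V2" by blast
  \<comment> \<open>The two reducts of the middle term are joined, and both size comparisons are
    transported to \<open>U3\<close>, where they compose.\<close>
  obtain U3 where U3: "(red S)\<^sup>*\<^sup>* U1 U3" "(red S)\<^sup>*\<^sup>* U2 U3" using reds_confluent * by blast
  obtain T3 where T3: "(red S)\<^sup>*\<^sup>* T1 T3" "sle S (size_le S) T3 U3"
    using reds_sle_right[OF U3(1)] * trans.IH reds_is_term by blast
  obtain V3 where V3: "(red S)\<^sup>*\<^sup>* V2 V3" "sle S (size_le S) U3 V3"
    using reds_sle[OF U3(2)] * trans.IH reds_is_term by blast
  have "sle S (size_le S) T3 V3" using T3 V3 sle_trans trans_size_le by blast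
  moreover have "(red S)\<^sup>*\<^sup>* T T3" "(red S)\<^sup>*\<^sup>* V V3" using * T3 V3 by (meson rtranclp_trans)+
  ultimately show ?case using trans.IH by blast
qed

text \<open>Converse of \<open>subtype_imp_reds_sle\<close>, used to return from components of
  normalised comparisons to subtyping.\<close>

lemma reds_sle_imp_subtype:
  assumes "(red S)\<^sup>*\<^sup>* T T'" "(red S)\<^sup>*\<^sup>* U U'" "sle S (size_le S) T' U'" "is_term S T" "is_term S U"
  shows "subtype S T U"
proof (rule subtype.conv)
  show "subtype S T' U'" using assms sle_subtype reds_is_term by blast
  show "joinable S T T'" "joinable S U' U" using assms by (auto simp: joinable_def)
qed

text \<open>Bodies are followed through their instances because \<open>red\<close> relates only
  terms without dangling indices.\<close>

lemma reds_Prd: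
  assumes "(red S)\<^sup>*\<^sup>* (Prd s U B) W"
  shows "\<exists>U' B'. W = Prd s U' B' \<and> (red S)\<^sup>*\<^sup>* U U' \<and>
    (\<forall>u. is_term S u \<longrightarrow> (red S)\<^sup>*\<^sup>* (opn 0 u B) (opn 0 u B'))"
  using assms
proof (induction rule: rtranclp_induct)
  case (step W1 W2)
  then obtain U1 B1 where *: "W1 = Prd s U1 B1" "(red S)\<^sup>*\<^sup>* U U1"
    "\<forall>u. is_term S u \<longrightarrow> (red S)\<^sup>*\<^sup>* (opn 0 u B) (opn 0 u B1)" by blast
  from step.hyps(2) *(1) have "context_closure S (red_root S) (Prd s U1 B1) W2"
    by (simp add: red_eq_context_closure)
  from this stable_red_root not_red_root_Prd show ?case
  proof (cases rule: context_closure_Prd_cases)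
    case (dom U2)
    then show ?thesis using * by (auto simp: red_eq_context_closure)
  next
    case (body B2)
    then have "\<forall>u. is_term S u \<longrightarrow> (red S)\<^sup>*\<^sup>* (opn 0 u B) (opn 0 u B2)"
      using *(3) by (auto simp: red_eq_context_closure intro: rtranclp.rtrancl_into_rtrancl)
    then show ?thesis using * body(1) by blast
  qed
qed auto

text \<open>The instance form of the last claim is independent of the names bound by the two
  products; a beta-redex supplies its argument for \<open>u\<close>.\<close>

lemma subtype_Prd:
  assumes "subtype S (Prd s U B) (Prd s' U' B')"
  shows "s = s'" "subtype S U' U" "\<And>u. is_term S u \<Longrightarrow> subtype S (opn 0 u B) (opn 0 u B')"
proof -
  from subtype_imp_reds_sle[OF assms] obtain X Y where
    trm: "is_term S (Prd s U B)" "is_term S (Prd s' U' B')" and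
    XY: "(red S)\<^sup>*\<^sup>* (Prd s U B) X" "(red S)\<^sup>*\<^sup>* (Prd s' U' B') Y" "sle S (size_le S) X Y" by blast
  from reds_Prd[OF XY(1)] obtain U1 B1 where 1: "X = Prd s U1 B1" "(red S)\<^sup>*\<^sup>* U U1"
    "\<forall>u. is_term S u \<longrightarrow> (red S)\<^sup>*\<^sup>* (opn 0 u B) (opn 0 u B1)" by blast
  from reds_Prd[OF XY(2)] obtain U1' B1' where 2: "Y = Prd s' U1' B1'" "(red S)\<^sup>*\<^sup>* U' U1'"
    "\<forall>u. is_term S u \<longrightarrow> (red S)\<^sup>*\<^sup>* (opn 0 u B') (opn 0 u B1')" by blast
  from sle_Prd XY(3) 1(1) 2(1) have 3: "s = s'" "sle S ((size_le S)\<inverse>) U1 U1'" "sle S (size_le S) B1 B1'"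
    by blast+
  show "s = s'" by fact
  have "sle S (size_le S) U1' U1" using sle_converse[OF 3(2)] by simp
  then show "subtype S U' U" using 1 2 trm reds_sle_imp_subtype by (auto simp: is_term_Prd)
  show "subtype S (opn 0 u B) (opn 0 u B')" if "is_term S u" for u
  proof (rule reds_sle_imp_subtype)
    show "(red S)\<^sup>*\<^sup>* (opn 0 u B) (opn 0 u B1)" "(red S)\<^sup>*\<^sup>* (opn 0 u B') (opn 0 u B1')"
      using 1 2 that by auto
    show "sle S (size_le S) (opn 0 u B1) (opn 0 u B1')" using 3 sle_opn by blast
    show "is_term S (opn 0 u B)" "is_term S (opn 0 u B')"
      using trm that is_term_opn is_term_Prd by blast+
  qed
qed

section \<open>Stability of subtyping under substitutions\<close>

lemma reds_subst: "(red S)\<^sup>*\<^sup>* t t' \<Longrightarrow> \<forall>x. is_term S (\<sigma> x) \<Longrightarrow> (red S)\<^sup>*\<^sup>* (subst \<sigma> t) (subst \<sigma> t')"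
  by (induction rule: rtranclp_induct) (auto intro: rtranclp.rtrancl_into_rtrancl red_subst)

lemma reds_size_subst:
  "(red S)\<^sup>*\<^sup>* t t' \<Longrightarrow> is_size_subst S \<phi> \<Longrightarrow> (red S)\<^sup>*\<^sup>* (size_subst \<phi> t) (size_subst \<phi> t')"
  by (induction rule: rtranclp_induct) (auto intro: rtranclp.rtrancl_into_rtrancl red_size_subst)

lemma subtype_subst:
  assumes "subtype S T U" "\<forall>x. is_term S (\<sigma> x)"
  shows "subtype S (subst \<sigma> T) (subst \<sigma> U)"
  using assms
proof (induction arbitrary: \<sigma> rule: subtype.induct)
  case (refl T)
  then show ?case by (auto intro: subtype.refl is_term_subst)
next
  case (size C a b ts)
  then show ?case by (auto simp: subst_foldl_App intro!: subtype.size is_term_subst)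
next
  case (prod U' U V V' x)
  obtain y where y: "\<forall>z \<in> fv V \<union> fv V'. y \<notin> fv (\<sigma> z)" "var_sort S y = var_sort S x"
    using fresh_for_subst[of "{}" "fv V \<union> fv V'" \<sigma>] by (metis finite.emptyI finite_Un finite_fv)
  have "subtype S (subst (\<sigma>(x := FVar y)) V) (subst (\<sigma>(x := FVar y)) V')"
    by (rule prod.IH(2)[OF is_term_upd[OF prod.prems is_term.intros(2)]])
  then show ?case using y prod.IH(1)[OF prod.prems]
    by (auto simp: subst_prd[of _ x y] intro: subtype.prod)
next
  case (conv T T' U' U)
  then show ?case unfolding joinable_def by (meson reds_subst subtype.conv[unfolded joinable_def])
next
  case (trans T U V)
  then show ?case by (blast intro: subtype.trans)
qed

lemma subtype_size_subst:
  assumes "subtype S T U" "is_size_subst S \<phi>"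
  shows "subtype S (size_subst \<phi> T) (size_subst \<phi> U)"
  using assms(1)
proof (induction rule: subtype.induct)
  case (refl T)
  then show ?case using assms(2) by (auto intro: subtype.refl is_term_size_subst)
next
  case (size C a b ts)
  then show ?case using assms(2)
    by (auto simp: size_subst_foldl_App intro!: subtype.size is_term_size_subst size_stable)
next
  case (prod U' U V V' x)
  then show ?case by (auto simp: size_subst_prd intro: subtype.prod)
next
  case (conv T T' U' U)
  then show ?case unfolding joinable_def
    using assms(2) by (meson reds_size_subst subtype.conv[unfolded joinable_def])
next
  case (trans T U V)
  then show ?case by (blast intro: subtype.trans)
qed

section \<open>Metatheory of typing\<close>

lemma typing_is_term: "typing S \<Gamma> t T \<Longrightarrow> is_term S t \<and> is_term S T"
proof (induction rule: typing.induct)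
  case (abs x U \<Gamma> v V s)
  then have "is_term S U" by (simp add: prd_def is_term_Prd)
  then show ?case using abs by (auto intro: is_term.intros)
next
  case (app \<Gamma> t x U V u)
  have "is_term S (subst1 x u V)"
    by (rule is_term_subst[OF app.hyps(2)]) (use app.IH is_term_FVar_upd in blast)
  then show ?case using app.IH by (auto intro: is_term.intros)
qed (auto intro: is_term.intros type_term is_term_size_subst)

text \<open>The second conjunct makes a newly declared variable fresh for every type declared before
  it.\<close>

lemma typing_fv:
  "typing S \<Gamma> t T \<Longrightarrow>
    fv t \<union> fv T \<subseteq> fst ` set \<Gamma> \<and> (\<forall>(x, U) \<in> set \<Gamma>. fv U \<subseteq> fst ` set \<Gamma>)"
proof (induction rule: typing.induct)
  case (app \<Gamma> t x U V u)
  have "fv (subst1 x u V) \<subseteq> fv V - {x} \<union> fv u" by (auto simp: fv_subst split: if_splits)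
  then show ?case using app by (auto simp: prd_def)
qed (auto simp: type_closed prd_def lam_def)

lemma typing_Cons:
  assumes "typing S ((x, U) # \<Gamma>) t T"
  shows "typing S \<Gamma> U (Sort (var_sort S x))" "x \<notin> fst ` set \<Gamma>"
  using assms by (induction "(x, U) # \<Gamma>" t T rule: typing.induct) auto

text \<open>
  The sort $s$ in the premise $\Gamma\vdash U:s$ of rule \<open>prod\<close> may differ from $s_x$. The judgement
  $\Gamma\vdash U:s_x$, which extending the environment requires, is only implicit in the
  formation of the environment $\Gamma,x:U$; here it comes with its own induction hypothesis.
\<close>

lemma typing_strong_induct [consumes 1, case_names ax size symb var weak prod abs app sub]:
  assumes "typing S \<Gamma> t T"
    and ax: "P [] (Sort Star) (Sort Box)"
    and size: "\<And>C a. C \<in> CFBox S \<Longrightarrow> a \<in> sizes S \<Longrightarrow> P [] (SSym C a) (sym_type S C)"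
    and symb: "\<And>f \<phi>. f \<notin> CFBox S \<Longrightarrow> is_size_subst S \<phi> \<Longrightarrow> P [] (Sym f) (size_subst \<phi> (sym_type S f))"
    and var: "\<And>\<Gamma> T x. typing S \<Gamma> T (Sort (var_sort S x)) \<Longrightarrow> P \<Gamma> T (Sort (var_sort S x)) \<Longrightarrow>
      x \<notin> fst ` set \<Gamma> \<Longrightarrow> P ((x, T) # \<Gamma>) (FVar x) T"
    and weak: "\<And>\<Gamma> t T U x. typing S \<Gamma> t T \<Longrightarrow> P \<Gamma> t T \<Longrightarrow> typing S \<Gamma> U (Sort (var_sort S x)) \<Longrightarrow>
      P \<Gamma> U (Sort (var_sort S x)) \<Longrightarrow> x \<notin> fst ` set \<Gamma> \<Longrightarrow> P ((x, U) # \<Gamma>) t T"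
    and prod: "\<And>\<Gamma> U s x V s'. typing S \<Gamma> U (Sort s) \<Longrightarrow> P \<Gamma> U (Sort s) \<Longrightarrow>
      typing S \<Gamma> U (Sort (var_sort S x)) \<Longrightarrow> P \<Gamma> U (Sort (var_sort S x)) \<Longrightarrow>
      typing S ((x, U) # \<Gamma>) V (Sort s') \<Longrightarrow> P ((x, U) # \<Gamma>) V (Sort s') \<Longrightarrow> P \<Gamma> (prd S x U V) (Sort s')"
    and abs: "\<And>x U \<Gamma> v V s. typing S ((x, U) # \<Gamma>) v V \<Longrightarrow> P ((x, U) # \<Gamma>) v V \<Longrightarrow>
      typing S \<Gamma> U (Sort (var_sort S x)) \<Longrightarrow> P \<Gamma> U (Sort (var_sort S x)) \<Longrightarrow>
      typing S \<Gamma> (prd S x U V) (Sort s) \<Longrightarrow> P \<Gamma> (prd S x U V) (Sort s) \<Longrightarrow>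
      P \<Gamma> (lam S x U v) (prd S x U V)"
    and app: "\<And>\<Gamma> t x U V u. typing S \<Gamma> t (prd S x U V) \<Longrightarrow> P \<Gamma> t (prd S x U V) \<Longrightarrow> is_term S V \<Longrightarrow>
      typing S \<Gamma> u U \<Longrightarrow> P \<Gamma> u U \<Longrightarrow> P \<Gamma> (App t u) (subst1 x u V)"
    and sub: "\<And>\<Gamma> t T T' s. typing S \<Gamma> t T \<Longrightarrow> P \<Gamma> t T \<Longrightarrow> typing S \<Gamma> T' (Sort s) \<Longrightarrow>
      P \<Gamma> T' (Sort s) \<Longrightarrow> subtype S T T' \<Longrightarrow> P \<Gamma> t T'"
  shows "P \<Gamma> t T"
proof -
  from assms(1)
  have "P \<Gamma> t T \<and> (\<forall>x U \<Delta>. \<Gamma> = (x, U) # \<Delta> \<longrightarrow> P \<Delta> U (Sort (var_sort S x)))"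
  proof (induction rule: typing.induct)
    case ax
    show ?case by (simp add: assms(2))
  next
    case (size C a)
    then show ?case by (simp add: assms(3))
  next
    case (symb f \<phi>)
    then show ?case by (simp add: assms(4))
  next
    case (var \<Gamma> T x)
    then show ?case by (simp add: assms(5))
  next
    case (weak \<Gamma> t T U x)
    then show ?case by (simp add: assms(6))
  next
    case (prod \<Gamma> U s x V s')
    then show ?case using assms(7)[of \<Gamma> U s x V s'] typing_Cons(1)[OF prod.hyps(2)] by simp
  next
    case (abs x U \<Gamma> v V s)
    then show ?case using assms(8)[of x U \<Gamma> v V s] typing_Cons(1)[OF abs.hyps(1)] by simp
  next
    case (app \<Gamma> t x U V u)
    then show ?case using assms(9)[of \<Gamma> t x U V u] by simp
  next
    case (sub \<Gamma> t T T' s)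
    then show ?case using assms(10)[of \<Gamma> t T T' s] by simp
  qed
  then show ?thesis by blast
qed

text \<open>The judgement on \<open>Sort Star\<close> serves from here on as the statement that an
  environment is well formed.\<close>

lemma typing_valid: "typing S \<Gamma> t T \<Longrightarrow> typing S \<Gamma> (Sort Star) (Sort Box)"
  by (induction rule: typing.induct) (auto intro: typing.ax typing.weak)

lemma typing_closed_weaken:
  assumes "typing S [] t T" "typing S \<Delta> (Sort Star) (Sort Box)"
  shows "typing S \<Delta> t T"
  using assms(2)
proof (induction \<Delta>)
  case (Cons p \<Delta>)
  obtain x U where p: "p = (x, U)" by (cases p)
  note * = typing_Cons[OF Cons.prems[unfolded p]]
  show ?case unfolding p by (rule typing.weak[OF Cons.IH[OF typing_valid[OF *(1)]] *])
qed (rule assms(1))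

lemma typing_FVar:
  "typing S \<Gamma> (Sort Star) (Sort Box) \<Longrightarrow> (z, W) \<in> set \<Gamma> \<Longrightarrow> typing S \<Gamma> (FVar z) W"
proof (induction \<Gamma>)
  case (Cons p \<Gamma>)
  obtain x U where p: "p = (x, U)" by (cases p)
  note * = typing_Cons[OF Cons.prems(1)[unfolded p]]
  show ?case
  proof (cases "(z, W) = p")
    case True
    then show ?thesis using typing.var[OF *] p by simp
  next
    case False
    then have "typing S \<Gamma> (FVar z) W" using Cons typing_valid[OF *(1)] by simp
    then show ?thesis unfolding p by (rule typing.weak[OF _ *])
  qed
qed simp

text \<open>Well-formedness of \<open>\<Delta>\<close> is stated separately because the last
  condition is vacuous for empty \<open>\<Gamma>\<close>. The first condition also covers undeclared
  variables, as stability of subtyping requires.\<close>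

definition typing_sub :: "('x \<times> ('x, 'f, 'h, 'z) trm) list \<Rightarrow> ('x \<Rightarrow> ('x, 'f, 'h, 'z) trm)
    \<Rightarrow> ('x \<times> ('x, 'f, 'h, 'z) trm) list \<Rightarrow> bool" where
  "typing_sub \<Gamma> \<sigma> \<Delta> \<longleftrightarrow> (\<forall>x. is_term S (\<sigma> x)) \<and> typing S \<Delta> (Sort Star) (Sort Box) \<and>
    (\<forall>(z, W) \<in> set \<Gamma>. typing S \<Delta> (\<sigma> z) (subst \<sigma> W))"

text \<open>The bound variable moves to \<open>y\<close> because \<open>x\<close> may already be
  declared in \<open>\<Delta>\<close>. Since \<open>x\<close> occurs in no declared type, changing
  \<open>\<sigma>\<close> at \<open>x\<close> leaves these types alone.\<close>

lemma typing_sub_lift: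
  assumes "typing S ((x, U) # \<Gamma>) v V" "typing_sub \<Gamma> \<sigma> \<Delta>"
    and U: "typing S \<Delta> (subst \<sigma> U) (Sort (var_sort S x))"
    and y: "y \<notin> fst ` set \<Delta>" "var_sort S y = var_sort S x"
  shows "typing_sub ((x, U) # \<Gamma>) (\<sigma>(x := FVar y)) ((y, subst \<sigma> U) # \<Delta>)"
proof -
  note x = typing_Cons[OF assms(1)]
  have fresh: "x \<notin> fv W" if "(z, W) \<in> set ((x, U) # \<Gamma>)" for z W
    using typing_fv[OF x(1)] x(2) that by fastforce
  have U': "typing S \<Delta> (subst \<sigma> U) (Sort (var_sort S y))" using U y by simp
  have "typing S ((y, subst \<sigma> U) # \<Delta>) ((\<sigma>(x := FVar y)) z) (subst (\<sigma>(x := FVar y)) W)"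
    if zW: "(z, W) \<in> set ((x, U) # \<Gamma>)" for z W
  proof (cases "(z, W) \<in> set \<Gamma>")
    case True
    then have "z \<noteq> x" using x(2) by force
    moreover have "typing S \<Delta> (\<sigma> z) (subst \<sigma> W)" using assms(2) True by (auto simp: typing_sub_def)
    ultimately show ?thesis using typing.weak[OF _ U' y(1)] by (simp add: subst_upd_fresh[OF fresh[OF zW]])
  next
    case False
    then have "z = x" "W = U" using zW by auto
    then show ?thesis using typing.var[OF U' y(1)] subst_upd_fresh[OF fresh[OF zW]] by simp
  qed
  moreover have "typing S ((y, subst \<sigma> U) # \<Delta>) (Sort Star) (Sort Box)"
    using typing.weak[OF _ U' y(1)] typing_valid[OF U] by blast
  moreover have "\<forall>z. is_term S ((\<sigma>(x := FVar y)) z)"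
    using assms(2) by (auto simp: typing_sub_def intro: is_term.intros)
  ultimately show ?thesis unfolding typing_sub_def by blast
qed

text \<open>
  Weakening, narrowing, renaming and instantiation of variables are all instances of
  stability under well-typed simultaneous substitutions.
\<close>

lemma typing_subst:
  assumes "typing S \<Gamma> t T" "typing_sub \<Gamma> \<sigma> \<Delta>"
  shows "typing S \<Delta> (subst \<sigma> t) (subst \<sigma> T)"
  using assms
proof (induction arbitrary: \<sigma> \<Delta> rule: typing_strong_induct)
  case ax
  then show ?case by (simp add: typing_sub_def)
next
  case (size C a)
  then have "typing S \<Delta> (SSym C a) (sym_type S C)"
    using typing.size[of C S a] type_typed[of C] typing_closed_weaken
    by (auto simp: CFBox_def typing_sub_def)
  then show ?case using subst_cong[of "sym_type S C" \<sigma> FVar] by (simp add: type_closed)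
next
  case (symb f \<phi>)
  then have "typing S \<Delta> (Sym f) (size_subst \<phi> (sym_type S f))"
    using typing.symb[of f S \<phi>] type_typed[of f] typing_closed_weaken by (auto simp: typing_sub_def)
  then show ?case
    using subst_cong[of "size_subst \<phi> (sym_type S f)" \<sigma> FVar] by (simp add: type_closed)
next
  case (var \<Gamma> T x)
  then show ?case by (simp add: typing_sub_def)
next
  case (weak \<Gamma> t T U x)
  then show ?case by (simp add: typing_sub_def)
next
  case (prod \<Gamma> U s x V s')
  obtain y where y: "y \<notin> fst ` set \<Delta>" "\<forall>z \<in> fv V. y \<notin> fv (\<sigma> z)" "var_sort S y = var_sort S x"
    using fresh_for_subst[of "fst ` set \<Delta>" "fv V"] by (metis List.finite_set finite_fv finite_imageI)
  have "typing S \<Delta> (subst \<sigma> U) (Sort (var_sort S x))" using prod.IH(2)[OF prod.prems] by simp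
  note lift = typing_sub_lift[OF prod.hyps(3) prod.prems this y(1,3)]
  have "typing S ((y, subst \<sigma> U) # \<Delta>) (subst (\<sigma>(x := FVar y)) V) (subst (\<sigma>(x := FVar y)) (Sort s'))"
    by (rule prod.IH(3)[OF lift])
  then show ?case using prod.IH(1)[OF prod.prems] y
    by (auto simp: subst_prd[of V x y] intro!: typing.prod)
next
  case (abs x U \<Gamma> v V s)
  obtain y where y: "y \<notin> fst ` set \<Delta>" "\<forall>z \<in> fv v \<union> fv V. y \<notin> fv (\<sigma> z)" "var_sort S y = var_sort S x"
    using fresh_for_subst[of "fst ` set \<Delta>" "fv v \<union> fv V"]
    by (metis List.finite_set finite_Un finite_fv finite_imageI)
  have "typing S \<Delta> (subst \<sigma> U) (Sort (var_sort S x))" using abs.IH(2)[OF abs.prems] by simp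
  note lift = typing_sub_lift[OF abs.hyps(1) abs.prems this y(1,3)]
  have "typing S ((y, subst \<sigma> U) # \<Delta>) (subst (\<sigma>(x := FVar y)) v) (subst (\<sigma>(x := FVar y)) V)"
    by (rule abs.IH(1)[OF lift])
  then show ?case using abs.IH(3)[OF abs.prems] y
    by (auto simp: subst_prd[of V x y] subst_lam[of v x y] intro!: typing.abs)
next
  case (app \<Gamma> t x U V u)
  obtain y where y: "\<forall>z \<in> fv V. y \<notin> fv (\<sigma> z)" "var_sort S y = var_sort S x"
    using fresh_for_subst[of "{}" "fv V"] by (metis finite.emptyI finite_fv)
  have "is_term S (subst (\<sigma>(x := FVar y)) V)"
    using app.hyps app.prems by (intro is_term_subst) (auto simp: typing_sub_def intro: is_term.intros)
  then show ?case using app.IH[OF app.prems] y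
    by (auto simp: subst_prd[of V x y] subst_subst1[of V x y] intro: typing.app)
next
  case (sub \<Gamma> t T T' s)
  then have "subtype S (subst \<sigma> T) (subst \<sigma> T')" by (auto simp: typing_sub_def intro: subtype_subst)
  then show ?case using sub.IH[OF sub.prems] by (auto intro: typing.sub)
qed

lemma typing_sub_FVarI:
  assumes "typing S \<Delta> (Sort Star) (Sort Box)" "\<And>z W. (z, W) \<in> set \<Gamma> \<Longrightarrow> typing S \<Delta> (FVar z) W"
  shows "typing_sub \<Gamma> FVar \<Delta>"
  using assms by (auto simp: typing_sub_def intro: is_term.intros)

lemma typing_weaken:
  assumes "typing S \<Gamma> t T" "set \<Gamma> \<subseteq> set \<Delta>" "typing S \<Delta> (Sort Star) (Sort Box)"
  shows "typing S \<Delta> t T"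
  using typing_subst[OF assms(1) typing_sub_FVarI[OF assms(3)]] typing_FVar[OF assms(3)] assms(2)
  by auto

lemma typing_rename:
  assumes "typing S ((x, U) # \<Gamma>) v V" "y \<notin> fst ` set \<Gamma>" "var_sort S y = var_sort S x"
  shows "typing S ((y, U) # \<Gamma>) (subst1 x (FVar y) v) (subst1 x (FVar y) V)"
proof -
  note U = typing_Cons(1)[OF assms(1)]
  have "typing_sub \<Gamma> FVar \<Gamma>" by (rule typing_sub_FVarI) (auto intro: typing_valid[OF U] typing_FVar)
  from typing_subst[OF assms(1) typing_sub_lift[OF assms(1) this _ assms(2,3)]] U show ?thesis by simp
qed

lemma typing_subst1:
  assumes "typing S ((x, U) # \<Gamma>) t T" "typing S \<Gamma> u U"
  shows "typing S \<Gamma> (subst1 x u t) (subst1 x u T)"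
proof (rule typing_subst[OF assms(1)])
  note x = typing_Cons[OF assms(1)]
  note valid = typing_valid[OF assms(2)]
  have fresh: "x \<notin> fv W" if "(z, W) \<in> set ((x, U) # \<Gamma>)" for z W
    using typing_fv[OF x(1)] x(2) that by fastforce
  have "typing S \<Gamma> ((FVar(x := u)) z) (subst1 x u W)" if zW: "(z, W) \<in> set ((x, U) # \<Gamma>)" for z W
  proof (cases "z = x")
    case True
    then have "W = U" using zW x(2) by force
    then show ?thesis using True assms(2) subst1_fresh[OF fresh[OF zW]] by simp
  next
    case False
    then show ?thesis using zW typing_FVar[OF valid, of z W] subst1_fresh[OF fresh[OF zW]] by simp
  qed
  moreover have "\<forall>z. is_term S ((FVar(x := u)) z)"
    using typing_is_term[OF assms(2)] by (auto intro: is_term.intros)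
  ultimately show "typing_sub ((x, U) # \<Gamma>) (FVar(x := u)) \<Gamma>"
    unfolding typing_sub_def using valid by blast
qed

text \<open>The identity is a well-typed substitution into the narrowed environment, where
  \<open>x\<close> regains type \<open>U\<close> by \<open>sub\<close>.\<close>

lemma typing_narrow:
  assumes "typing S ((x, U) # \<Gamma>) t T" "typing S \<Gamma> U' (Sort (var_sort S x))" "subtype S U' U"
  shows "typing S ((x, U') # \<Gamma>) t T"
proof -
  note x = typing_Cons[OF assms(1)]
  have valid: "typing S ((x, U') # \<Gamma>) (Sort Star) (Sort Box)"
    using typing.weak[OF typing_valid[OF assms(2)] assms(2) x(2)] .
  have "typing S ((x, U') # \<Gamma>) (FVar x) U"
    using typing.sub[OF typing.var[OF assms(2) x(2)] typing.weak[OF x(1) assms(2) x(2)] assms(3)] .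
  then have "typing_sub ((x, U) # \<Gamma>) FVar ((x, U') # \<Gamma>)"
    by (intro typing_sub_FVarI valid) (auto intro: typing_FVar[OF valid])
  from typing_subst[OF assms(1) this] show ?thesis by simp
qed

section \<open>Inversion of typing for products and abstractions\<close>

lemma typing_insert:
  assumes "typing S ((y, U) # \<Gamma>) t T" "typing S \<Gamma> W (Sort (var_sort S z))" "z \<notin> fst ` set \<Gamma>" "y \<noteq> z"
  shows "typing S ((y, U) # (z, W) # \<Gamma>) t T"
proof (rule typing_weaken[OF assms(1)])
  note y = typing_Cons[OF assms(1)]
  have "typing S ((z, W) # \<Gamma>) U (Sort (var_sort S y))" using typing.weak[OF y(1) assms(2,3)] .
  then show "typing S ((y, U) # (z, W) # \<Gamma>) (Sort Star) (Sort Box)"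
    using typing.weak[of S "(z, W) # \<Gamma>" "Sort Star" "Sort Box" U y] typing_valid y assms(4) by auto
qed auto

text \<open>A raw product does not reveal the name used in its derivation, so the body is typed for
  every admissible \<open>y\<close>; \<open>typing_rename\<close> changes the name.\<close>

lemma typing_Prd_body:
  assumes "typing S \<Gamma> (Prd s U B) T"
  shows "\<exists>s'. \<forall>y. y \<notin> fst ` set \<Gamma> \<longrightarrow> var_sort S y = s \<longrightarrow>
    typing S ((y, U) # \<Gamma>) (opn 0 (FVar y) B) (Sort s')"
  using assms
proof (induction \<Gamma> "Prd s U B" T rule: typing.induct)
  case (weak \<Gamma> T W z)
  then obtain s' where "\<forall>y. y \<notin> fst ` set \<Gamma> \<longrightarrow> var_sort S y = s \<longrightarrow>
    typing S ((y, U) # \<Gamma>) (opn 0 (FVar y) B) (Sort s')" by blast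
  \<comment> \<open>The new declaration \<open>z\<close> has to go below \<open>y\<close>, which
    rule \<open>weak\<close> alone cannot achieve.\<close>
  then show ?case using typing_insert[OF _ weak.hyps(3,5)] by (intro exI[of _ s']) auto
next
  case (prod \<Gamma> U' s1 x V s')
  then have eq: "U' = U" "s = var_sort S x" "B = close 0 x V" by (auto simp: prd_def)
  have "wf_at S 0 V" using typing_is_term[OF prod.hyps(3)] by (simp add: is_term_iff)
  then show ?case using typing_rename[OF prod.hyps(3)] unfolding eq
    by (intro exI[of _ s']) (auto simp: opn_close)
qed (auto simp: lam_def prd_def)

text \<open>The product found has the annotation \<open>U\<close> itself as domain; transitivity
  gathers all uses of \<open>sub\<close> into a single subtyping.\<close>

lemma typing_Lam_body:
  assumes "typing S \<Gamma> (Lam s U B) T"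
  shows "\<exists>V s'. typing S \<Gamma> (Prd s U V) (Sort s') \<and> subtype S (Prd s U V) T \<and>
    (\<forall>y. y \<notin> fst ` set \<Gamma> \<longrightarrow> var_sort S y = s \<longrightarrow>
      typing S ((y, U) # \<Gamma>) (opn 0 (FVar y) B) (opn 0 (FVar y) V))"
  using assms
proof (induction \<Gamma> "Lam s U B" T rule: typing.induct)
  case (weak \<Gamma> T W z)
  then obtain V s' where *: "typing S \<Gamma> (Prd s U V) (Sort s')" "subtype S (Prd s U V) T"
    "\<forall>y. y \<notin> fst ` set \<Gamma> \<longrightarrow> var_sort S y = s \<longrightarrow>
      typing S ((y, U) # \<Gamma>) (opn 0 (FVar y) B) (opn 0 (FVar y) V)" by blast
  have "typing S ((z, W) # \<Gamma>) (Prd s U V) (Sort s')"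
    using typing.weak[OF *(1) weak.hyps(3,5)] .
  then show ?case using *(2,3) typing_insert[OF _ weak.hyps(3,5)]
    by (intro exI[of _ V] exI[of _ s']) auto
next
  case (abs x U' \<Gamma> v V s')
  then have eq: "U' = U" "s = var_sort S x" "B = close 0 x v" by (auto simp: lam_def)
  have wf: "wf_at S 0 v" "wf_at S 0 V" using typing_is_term[OF abs.hyps(1)] by (simp_all add: is_term_iff)
  have *: "prd S x U' V = Prd s U (close 0 x V)" by (simp add: prd_def eq)
  have "subtype S (Prd s U (close 0 x V)) (Prd s U (close 0 x V))"
    using typing_is_term[OF abs.hyps(3)] unfolding * by (auto intro: subtype.refl)
  moreover have "\<forall>y. y \<notin> fst ` set \<Gamma> \<longrightarrow> var_sort S y = s \<longrightarrow>
      typing S ((y, U) # \<Gamma>) (opn 0 (FVar y) B) (opn 0 (FVar y) (close 0 x V))"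
    using typing_rename[OF abs.hyps(1)] wf unfolding eq by (auto simp: opn_close)
  ultimately show ?case using abs.hyps(3) unfolding * by blast
next
  case (sub \<Gamma> T T' s1)
  then show ?case by (blast intro: subtype.trans)
qed (auto simp: lam_def prd_def)

lemma typing_opn:
  assumes "\<And>y. y \<notin> fst ` set \<Gamma> \<Longrightarrow> var_sort S y = s \<Longrightarrow>
      typing S ((y, U) # \<Gamma>) (opn 0 (FVar y) B) (opn 0 (FVar y) V)"
    and "typing S \<Gamma> u U"
  shows "typing S \<Gamma> (opn 0 u B) (opn 0 u V)"
proof -
  \<comment> \<open>Freshness for \<open>B\<close> and \<open>V\<close> makes substitution of
    \<open>u\<close> for \<open>y\<close> in the opened bodies the same as opening with
    \<open>u\<close>.\<close>
  obtain y where y: "y \<notin> fst ` set \<Gamma> \<union> fv B \<union> fv V" "var_sort S y = s"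
    using fresh_var[of "fst ` set \<Gamma> \<union> fv B \<union> fv V" s] by auto
  have "wf_at S 0 u" using typing_is_term[OF assms(2)] by (simp add: is_term_iff)
  moreover have "typing S \<Gamma> (subst1 y u (opn 0 (FVar y) B)) (subst1 y u (opn 0 (FVar y) V))"
    by (rule typing_subst1[OF assms(1) assms(2)]) (use y in simp_all)
  ultimately show ?thesis using y by (simp add: subst1_opn[of S])
qed

lemma typing_prd_inst:
  assumes "typing S \<Gamma> (prd S x U V) T" "is_term S V" "typing S \<Gamma> u U"
  shows "\<exists>s. typing S \<Gamma> (subst1 x u V) (Sort s)"
proof -
  from typing_Prd_body[OF assms(1)[unfolded prd_def]] obtain s' where
    "\<forall>y. y \<notin> fst ` set \<Gamma> \<longrightarrow> var_sort S y = var_sort S x \<longrightarrow>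
      typing S ((y, U) # \<Gamma>) (opn 0 (FVar y) (close 0 x V)) (Sort s')" by blast
  then have *: "typing S ((y, U) # \<Gamma>) (opn 0 (FVar y) (close 0 x V)) (opn 0 (FVar y) (Sort s'))"
    if "y \<notin> fst ` set \<Gamma>" "var_sort S y = var_sort S x" for y
    using that by simp
  have "opn 0 u (close 0 x V) = subst1 x u V" using assms(2)
    by (simp add: opn_close[of S] is_term_iff)
  moreover have "typing S \<Gamma> (opn 0 u (close 0 x V)) (opn 0 u (Sort s'))"
    by (rule typing_opn[OF * assms(3)])
  ultimately show ?thesis by auto
qed

text \<open>Needed to type the instance \<open>size_subst \<phi> (sym_type S f)\<close> given by
  rule \<open>symb\<close>. Rule \<open>symb\<close> is preserved by composing size substitutions,
  rule \<open>size\<close> because the types of symbols in \<open>CFBox S\<close> have no size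
  variables.\<close>

lemma typing_size_subst:
  assumes "typing S \<Gamma> t T" and \<phi>: "is_size_subst S \<phi>"
  shows "typing S (map (apsnd (size_subst \<phi>)) \<Gamma>) (size_subst \<phi> t) (size_subst \<phi> T)"
  using assms(1)
proof (induction rule: typing.induct)
  case (var \<Gamma> T x)
  then show ?case by (simp add: image_image typing.var)
next
  case (weak \<Gamma> t T U x)
  then show ?case by (simp add: image_image typing.weak)
next
  case (size C a)
  then have "size_subst \<phi> (sym_type S C) = sym_type S C"
    by (intro size_subst_closed type_size_vars) (simp add: CFBox_def)
  then show ?case using size \<phi> by (auto intro: typing.size sexp_subst_sizes)
next
  case (symb f \<psi>)
  have "is_size_subst S (\<lambda>z. sexp_subst \<phi> (\<psi> z))"
    using symb \<phi> sexp_subst_sizes unfolding is_size_subst_def by blast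
  then show ?case using symb typing.symb[of f S "\<lambda>z. sexp_subst \<phi> (\<psi> z)"] by (simp add: size_subst_size_subst)
next
  case (app \<Gamma> t x U V u)
  then show ?case using \<phi>
    by (auto simp: size_subst_prd size_subst_subst1 intro!: typing.app is_term_size_subst)
next
  case (sub \<Gamma> t T T' s)
  then show ?case using \<phi> by (auto intro: typing.sub subtype_size_subst)
qed (auto simp: size_subst_prd size_subst_lam image_image intro: typing.intros)

text \<open>The exception \<open>Sort Box\<close> is harmless for applications, since it is not a
  product.\<close>

lemma typing_type:
  assumes "typing S \<Gamma> t T"
  shows "T = Sort Box \<or> (\<exists>s. typing S \<Gamma> T (Sort s))"
  using assms
proof (induction rule: typing.induct)
  case (symb f \<phi>)
  then show ?case using typing_size_subst[OF symb.hyps(3,2)] by auto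
next
  case (prod \<Gamma> U s x V s')
  then show ?case using typing_valid[OF prod.hyps(1)] by (cases s') auto
next
  case (app \<Gamma> t x U V u)
  then obtain s where "typing S \<Gamma> (prd S x U V) (Sort s)" by (auto simp: prd_def)
  then show ?case using typing_prd_inst app.hyps by blast
qed (auto intro: typing.weak)

section \<open>Subject reduction\<close>

lemma beta_is_red: "beta S t t' \<Longrightarrow> red S t t'"
  by (simp add: red_def)

text \<open>This fails for \<open>red\<close>: right-hand sides of rules may have extra variables.\<close>

lemma beta_fv: "beta S t t' \<Longrightarrow> fv t' \<subseteq> fv t"
  unfolding beta_def
proof (induction rule: context_closure.induct)
  case (root t t')
  then show ?case by (auto elim!: beta_root.cases simp: lam_def fv_subst split: if_splits)
qed (auto simp: lam_def prd_def)

text \<open>Disposes of the atomic cases of the final induction. It is specific to beta: a rule may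
  rewrite a bare symbol.\<close>

lemma beta_not_atom:
  assumes "beta S t W"
  shows "(\<exists>u v. t = App u v) \<or> (\<exists>s U B. t = Lam s U B) \<or> (\<exists>s U B. t = Prd s U B)"
  using assms unfolding beta_def
  by (cases rule: context_closure.cases) (auto simp: beta_root.simps lam_def prd_def)

lemma beta_App_cases:
  assumes "beta S (App t u) W"
  obtains (root) s U B where "t = Lam s U B" "W = opn 0 u B"
    | (left) t' where "W = App t' u" "beta S t t'"
    | (right) u' where "W = App t u'" "beta S u u'"
  using assms unfolding beta_def
proof (cases rule: context_closure.cases)
  case root
  then obtain x U v where "t = lam S x U v" "W = subst1 x u v" "is_term S v"
    by (auto elim: beta_root.cases)
  then show ?thesis using that(1) by (simp add: lam_def opn_close[of S] is_term_iff)
qed (use that in \<open>auto simp: lam_def prd_def beta_def\<close>)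

lemma red_subtype: "red S t t' \<Longrightarrow> subtype S t t' \<and> subtype S t' t"
  using red_is_term[of t t'] by (auto intro: reds_sle_imp_subtype sle.refl)

lemma reds_app:
  assumes "(red S)\<^sup>*\<^sup>* t t'" "(red S)\<^sup>*\<^sup>* u u'" "is_term S t" "is_term S u"
  shows "(red S)\<^sup>*\<^sup>* (App t u) (App t' u')"
proof -
  from assms(1) have "(red S)\<^sup>*\<^sup>* (App t u) (App t' u)"
    by (induction rule: rtranclp_induct)
      (use assms(4) in \<open>auto intro: rtranclp.rtrancl_into_rtrancl red_appL\<close>)
  moreover have "is_term S t'" using assms reds_is_term by blast
  with assms(2) have "(red S)\<^sup>*\<^sup>* (App t' u) (App t' u')"
    by (induction rule: rtranclp_induct) (auto intro: rtranclp.rtrancl_into_rtrancl red_appR)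
  ultimately show ?thesis by simp
qed

lemma reds_lam:
  assumes "(red S)\<^sup>*\<^sup>* U U'" "(red S)\<^sup>*\<^sup>* v v'" "is_term S U" "is_term S v"
  shows "(red S)\<^sup>*\<^sup>* (lam S x U v) (lam S x U' v')"
proof -
  from assms(1) have "(red S)\<^sup>*\<^sup>* (lam S x U v) (lam S x U' v)"
    by (induction rule: rtranclp_induct)
      (use assms(4) in \<open>auto intro: rtranclp.rtrancl_into_rtrancl red_lamL\<close>)
  moreover have "is_term S U'" using assms reds_is_term by blast
  with assms(2) have "(red S)\<^sup>*\<^sup>* (lam S x U' v) (lam S x U' v')"
    by (induction rule: rtranclp_induct) (auto intro: rtranclp.rtrancl_into_rtrancl red_lamR)
  ultimately show ?thesis by simp
qed

text \<open>Relates the types of an application before and after reducing its argument. Many steps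
  are needed, as the variable may occur several times.\<close>

lemma reds_subst_arg:
  assumes "is_term S t" "\<forall>x. is_term S (\<sigma> x)" "\<forall>x. is_term S (\<tau> x)" "\<forall>x. (red S)\<^sup>*\<^sup>* (\<sigma> x) (\<tau> x)"
  shows "(red S)\<^sup>*\<^sup>* (subst \<sigma> t) (subst \<tau> t)"
  using assms
proof (induction arbitrary: \<sigma> \<tau> rule: is_term.induct)
  case (5 U v x)
  have "finite ((\<Union>z \<in> fv v. fv (\<sigma> z)) \<union> (\<Union>z \<in> fv v. fv (\<tau> z)))" by simp
  then obtain y where y: "y \<notin> (\<Union>z \<in> fv v. fv (\<sigma> z)) \<union> (\<Union>z \<in> fv v. fv (\<tau> z))" "var_sort S y = var_sort S x"
    by (rule fresh_var)
  have "(red S)\<^sup>*\<^sup>* (subst (\<sigma>(x := FVar y)) v) (subst (\<tau>(x := FVar y)) v)"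
    by (rule "5.IH"(2)) (use 5 in \<open>auto intro: is_term.intros\<close>)
  moreover have "is_term S (subst \<sigma> U)" using is_term_subst "5.hyps"(1) "5.prems"(1) .
  moreover have "is_term S (subst (\<sigma>(x := FVar y)) v)"
    by (rule is_term_subst[OF "5.hyps"(2) is_term_upd[OF "5.prems"(1) is_term.intros(2)]])
  moreover have "subst \<sigma> (lam S x U v) = lam S y (subst \<sigma> U) (subst (\<sigma>(x := FVar y)) v)"
    "subst \<tau> (lam S x U v) = lam S y (subst \<tau> U) (subst (\<tau>(x := FVar y)) v)"
    using y by (auto intro!: subst_lam)
  ultimately show ?case using reds_lam "5.IH"(1)[OF "5.prems"] by simp
next
  case (6 U v x)
  have "finite ((\<Union>z \<in> fv v. fv (\<sigma> z)) \<union> (\<Union>z \<in> fv v. fv (\<tau> z)))" by simp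
  then obtain y where y: "y \<notin> (\<Union>z \<in> fv v. fv (\<sigma> z)) \<union> (\<Union>z \<in> fv v. fv (\<tau> z))" "var_sort S y = var_sort S x"
    by (rule fresh_var)
  have "(red S)\<^sup>*\<^sup>* (subst (\<sigma>(x := FVar y)) v) (subst (\<tau>(x := FVar y)) v)"
    by (rule "6.IH"(2)) (use 6 in \<open>auto intro: is_term.intros\<close>)
  moreover have "is_term S (subst \<sigma> U)" using is_term_subst "6.hyps"(1) "6.prems"(1) .
  moreover have "is_term S (subst (\<sigma>(x := FVar y)) v)"
    by (rule is_term_subst[OF "6.hyps"(2) is_term_upd[OF "6.prems"(1) is_term.intros(2)]])
  moreover have "subst \<sigma> (prd S x U v) = prd S y (subst \<sigma> U) (subst (\<sigma>(x := FVar y)) v)"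
    "subst \<tau> (prd S x U v) = prd S y (subst \<tau> U) (subst (\<tau>(x := FVar y)) v)"
    using y by (auto intro!: subst_prd)
  ultimately show ?case using reds_prd "6.IH"(1)[OF "6.prems"] by simp
next
  case (7 t u)
  then show ?case unfolding subst.simps by (blast intro: reds_app is_term_subst)
qed simp_all

lemma beta_preserves_typing_app:
  assumes t: "typing S \<Gamma> t (prd S x U V)" and V: "is_term S V" and u: "typing S \<Gamma> u U"
    and IH: "\<And>t'. beta S t t' \<Longrightarrow> typing S \<Gamma> t' (prd S x U V)" "\<And>u'. beta S u u' \<Longrightarrow> typing S \<Gamma> u' U"
    and "beta S (App t u) W"
  shows "typing S \<Gamma> W (subst1 x u V)"
proof -
  obtain s where s: "typing S \<Gamma> (prd S x U V) (Sort s)" using typing_type[OF t] by (auto simp: prd_def)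
  obtain s' where s': "typing S \<Gamma> (subst1 x u V) (Sort s')" using typing_prd_inst[OF s V u] by blast
  have tu: "is_term S u" using typing_is_term[OF u] by simp
  from assms(6) show ?thesis
  proof (cases rule: beta_App_cases)
    case (root s0 U0 B)
    from typing_Lam_body[OF t[unfolded root(1)]] obtain V0 s1 where
      *: "typing S \<Gamma> (Prd s0 U0 V0) (Sort s1)" "subtype S (Prd s0 U0 V0) (prd S x U V)"
      and body: "\<And>y. y \<notin> fst ` set \<Gamma> \<Longrightarrow> var_sort S y = s0 \<Longrightarrow>
        typing S ((y, U0) # \<Gamma>) (opn 0 (FVar y) B) (opn 0 (FVar y) V0)" by blast
    note inj = subtype_Prd[OF *(2)[unfolded prd_def]]
    \<comment> \<open>Some admissible \<open>y\<close> is needed only because the environment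
      extended by it shows that \<open>U0\<close> has a sort; \<open>sub\<close> then gives
      \<open>u\<close> the type \<open>U0\<close>.\<close>
    obtain y where "y \<notin> fst ` set \<Gamma>" "var_sort S y = s0" using fresh_var[of "fst ` set \<Gamma>" s0] by auto
    from typing_Cons(1)[OF body[OF this]] have "typing S \<Gamma> u U0" using typing.sub[OF u] inj(2) by blast
    from typing_opn[OF body this] have "typing S \<Gamma> W (opn 0 u V0)" using root by simp
    moreover have "subtype S (opn 0 u V0) (subst1 x u V)"
      using inj(3)[OF tu] V by (simp add: opn_close[of S] is_term_iff)
    ultimately show ?thesis using typing.sub s' by blast
  next
    case (left t')
    then show ?thesis using typing.app[OF IH(1) V u] by simp
  next
    case (right u')
    then have u': "typing S \<Gamma> u' U" using IH by simp
    have red: "red S u u'" using right beta_is_red by simp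
    \<comment> \<open>Rule \<open>app\<close> now yields \<open>subst1 x u' V\<close>; this
      reduction justifies going back to the original type by \<open>sub\<close>.\<close>
    have "(red S)\<^sup>*\<^sup>* (subst1 x u V) (subst1 x u' V)"
      using red red_is_term[OF red] by (intro reds_subst_arg V) (auto intro: is_term.intros)
    then have "subtype S (subst1 x u' V) (subst1 x u V)"
      using typing_is_term[OF s'] reds_is_term by (auto intro: reds_sle_imp_subtype sle.refl)
    then show ?thesis using typing.sub[OF typing.app[OF t V u'] s'] right by simp
  qed
qed

lemma beta_preserves_typing:
  assumes "typing S \<Gamma> t T" "beta S t t'"
  shows "typing S \<Gamma> t' T"
  using assms
proof (induction arbitrary: t' rule: typing_strong_induct)
  case (weak \<Gamma> t T U x)
  then show ?case by (blast intro: typing.weak)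
next
  case (prod \<Gamma> U s x V s')
  note fv = typing_fv[OF typing.prod[OF prod.hyps(1,3)]] and x = typing_Cons(2)[OF prod.hyps(3)]
  have V: "opn 0 (FVar x) (close 0 x V) = V"
    using typing_is_term[OF prod.hyps(3)] by (simp add: opn_close[of S] is_term_iff)
  have root: "\<not> beta_root S (prd S x U V) t'" using not_red_root_Prd by (auto simp: prd_def)
  from prod.prems[unfolded beta_def prd_def] stable_beta_root root[unfolded prd_def] show ?case
  proof (cases rule: context_closure_Prd_cases)
    case (dom U')
    then have U': "beta S U U'" by (simp add: beta_def)
    have "subtype S U' U" using red_subtype beta_is_red U' by blast
    \<comment> \<open>The second induction hypothesis is used because declaring \<open>x\<close>
      requires \<open>U'\<close> to have the sort of \<open>x\<close>; the sort \<open>s\<close> in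
      the premise may be another.\<close>
    then have "typing S ((x, U') # \<Gamma>) V (Sort s')"
      using typing_narrow[OF prod.hyps(3)] prod.IH(2)[OF U'] by blast
    then have "typing S \<Gamma> (prd S x U' V) (Sort s')" using typing.prod[OF prod.IH(1)[OF U']] by blast
    then show ?thesis using dom by (simp add: prd_def)
  next
    case (body B')
    \<comment> \<open>Beta creates no variables and \<open>\<Gamma>\<close> does not declare
      \<open>x\<close>, so the raw reduct can be reopened with the same \<open>x\<close>, to which
      the induction hypothesis applies.\<close>
    have "x \<notin> fv B'" using beta_fv[OF prod.prems] fv x body(1) by (auto simp: prd_def)
    then have B': "close 0 x (opn 0 (FVar x) B') = B'" by (rule close_opn)
    have *: "beta S V (opn 0 (FVar x) B')"
      using body(2)[of "FVar x"] V by (simp add: beta_def is_term.intros(2))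
    have "typing S \<Gamma> (prd S x U (opn 0 (FVar x) B')) (Sort s')"
      using typing.prod[OF prod.hyps(1) prod.IH(3)[OF *]] .
    then show ?thesis using body(1) B' by (simp add: prd_def)
  qed
next
  case (abs x U \<Gamma> v V s)
  note fv = typing_fv[OF typing.abs[OF abs.hyps(1,3)]] and x = typing_Cons(2)[OF abs.hyps(1)]
  have trm: "is_term S v" "is_term S V" using typing_is_term[OF abs.hyps(1)] by auto
  then have v: "opn 0 (FVar x) (close 0 x v) = v" by (simp add: opn_close[of S] is_term_iff)
  have root: "\<not> beta_root S (lam S x U v) t'" by (auto simp: lam_def elim: beta_root.cases)
  from abs.prems[unfolded beta_def lam_def] stable_beta_root root[unfolded lam_def] show ?case
  proof (cases rule: context_closure_Lam_cases)
    case (dom U')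
    then have U': "beta S U U'" by (simp add: beta_def)
    have "subtype S U' U" using red_subtype beta_is_red U' by blast
    then have v': "typing S ((x, U') # \<Gamma>) v V"
      using typing_narrow[OF abs.hyps(1)] abs.IH(2)[OF U'] by blast
    \<comment> \<open>Reducing the annotation changes the product type too. The hypothesis for the
      typing of the product gives the new one a sort, and \<open>sub\<close> restores the old
      one.\<close>
    have prd: "beta S (prd S x U V) (prd S x U' V)"
      using U' trm by (simp add: beta_def context_closure.prdL)
    then have "subtype S (prd S x U' V) (prd S x U V)" using red_subtype beta_is_red by blast
    then have "typing S \<Gamma> (lam S x U' v) (prd S x U V)"
      using typing.sub[OF typing.abs[OF v' abs.IH(3)[OF prd]] abs.hyps(3)] by blast
    then show ?thesis using dom by (simp add: lam_def)
  next
    case (body B')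
    have "x \<notin> fv B'" using beta_fv[OF abs.prems] fv x body(1) by (auto simp: lam_def)
    then have B': "close 0 x (opn 0 (FVar x) B') = B'" by (rule close_opn)
    have *: "beta S v (opn 0 (FVar x) B')"
      using body(2)[of "FVar x"] v by (simp add: beta_def is_term.intros(2))
    have "typing S \<Gamma> (lam S x U (opn 0 (FVar x) B')) (prd S x U V)"
      using typing.abs[OF abs.IH(1)[OF *] abs.hyps(3)] .
    then show ?thesis using body(1) B' by (simp add: lam_def)
  qed
next
  case (app \<Gamma> t x U V u)
  then show ?case by (blast intro: beta_preserves_typing_app)
next
  case (sub \<Gamma> t T T' s)
  then show ?case by (blast intro: typing.sub)
qed (auto dest: beta_not_atom)

end

theorem mainTheorem10:
  fixes S :: "('x, 'f, 'h, 'z) sys"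
    and \<Gamma> :: "('x \<times> ('x, 'f, 'h, 'z) trm) list"
    and t t' T :: "('x, 'f, 'h, 'z) trm"
  assumes "cacsa S"
    and "typing S \<Gamma> t T"
    and "beta S t t'"
  shows "typing S \<Gamma> t' T"
  using cacsa.beta_preserves_typing[OF assms] .

end
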